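(* Let $d\geq 1$, let $p=p_d=\frac{2d+1}{4d}$, let $(S_n)$ be the $d$-dimensional elephant random walk with memory parameter $p$, and let $G_n=\frac{1}{n}\sum_{k=1}^n S_k$. Then $$\frac{1}{\sqrt{n\log n}}G_n\xrightarrow{\ \mathcal{L}\ }\mathcal{N}\Bigl(0,\frac{4}{9d}I_d\Bigr)$$ as $n\to\infty$.
   Context: The $d$-dimensional elephant random walk (ERW) with memory parameter $p\in[0,1]$ is defined as follows. Let $e_1,\dots,e_d$ be the standard basis of $\mathbb{R}^d$; the $2d$ directions are $\pm e_1,\dots,\pm e_d$. Set $S_0=0$. The first step $X_1$ is uniformly distributed on the $2d$ directions. For $n\geq 1$, given $X_1,\dots,X_n$, an index $k$ is chosen uniformly at random in $\{1,\dots,n\}$, and then $X_{n+1}=X_k$ with probability $p$, while $X_{n+1}$ equals each of the $2d-1$ remaining directions with probability $(1-p)/(2d-1)$. The position is $S_{n+1}=S_n+X_{n+1}$. $I_d$ is the identity matrix of order $d$; $\xrightarrow{\mathcal{L}}$ denotes convergence in distribution. *)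

theory Defs
  imports "HOL-Probability.Probability"
begin

definition erw_dirs :: "(real ^ 'd) set" where
  "erw_dirs = {v. \<exists>i. v = axis i 1 \<or> v = axis i (-1)}"

text \<open>Law of the first n steps (X_1, ..., X_n) of the elephant random walk with
  memory parameter p, as a list of length n (list index j = step j+1).\<close>
fun erw_steps :: "real \<Rightarrow> nat \<Rightarrow> (real ^ 'd :: finite) list pmf" where
  "erw_steps p 0 = return_pmf []"
| "erw_steps p (Suc 0) = map_pmf (\<lambda>x. [x]) (pmf_of_set erw_dirs)"
| "erw_steps p (Suc (Suc n)) =
     do { xs \<leftarrow> erw_steps p (Suc n);
          k \<leftarrow> pmf_of_set {0..<length xs};
          b \<leftarrow> bernoulli_pmf p;
          x \<leftarrow> (if b then return_pmf (xs ! k) else pmf_of_set (erw_dirs - {xs ! k}));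
          return_pmf (xs @ [x]) }"

definition erw_pos :: "(real ^ 'd) list \<Rightarrow> nat \<Rightarrow> real ^ 'd" where
  "erw_pos xs k = (\<Sum>j<k. xs ! j)"

definition erw_bary :: "(real ^ 'd) list \<Rightarrow> nat \<Rightarrow> real ^ 'd" where
  "erw_bary xs n = (1 / real n) *\<^sub>R (\<Sum>k=1..n. erw_pos xs k)"

definition gauss_iso :: "real \<Rightarrow> (real ^ 'd :: finite) measure" where
  "gauss_iso s = density lborel (\<lambda>x. ennreal (\<Prod>i\<in>UNIV. normal_density 0 (sqrt s) (x $ i)))"

definition conv_in_law :: "(nat \<Rightarrow> 'a :: metric_space measure) \<Rightarrow> 'a measure \<Rightarrow> bool" where
  "conv_in_law M L \<longleftrightarrow>
     (\<forall>f :: 'a \<Rightarrow> real. continuous_on UNIV f \<longrightarrow> bounded (range f) \<longrightarrow>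
        ((\<lambda>n. integral\<^sup>L (M n) f) \<longlonglongrightarrow> integral\<^sup>L L f))"

end

theory Submission
  imports Defs
begin

text \<open>At the critical memory parameter the next step is, with equal probability, a uniformly chosen
  past step or a uniformly chosen direction. Hence, for a function \<open>g\<close> on the directions with mean
  zero, \<open>W\<^sub>n = g X\<^sub>1 + \<dots> + g X\<^sub>n\<close> has conditional drift \<open>W\<^sub>n / (2n)\<close> and \<open>E W\<^sub>n\<^sup>2\<close> is of order
  \<open>n log n\<close>. With \<open>T\<^sub>n = W\<^sub>1 + \<dots> + W\<^sub>n\<close>, the sequence \<open>T\<^sub>n - (2n + 1) / 3 * W\<^sub>n\<close> is a martingale with
  second moment of order \<open>n\<^sup>3\<close>, so the centre of mass differs from \<open>2/3\<close> of the position by a term that is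
  negligible against \<open>sqrt (n log n)\<close>.

  For the position, let \<open>\<psi>\<^sub>n = E exp (i \<theta> W\<^sub>n / sqrt n)\<close>. Conditioning on the first \<open>n\<close> steps gives
  \<open>\<psi>\<^sub>n\<^sub>+\<^sub>1 = exp (- \<theta>\<^sup>2 \<sigma>\<^sup>2 / (2 (n + 1))) \<psi>\<^sub>n\<close> up to an error of order \<open>\<theta> n powr (- 5/4)\<close>; the deviation of
  the conditional variance from \<open>\<sigma>\<^sup>2\<close> is controlled by the second moment bound applied to \<open>g\<^sup>2 - \<sigma>\<^sup>2\<close>.
  The errors are summable, so \<open>\<psi>\<^sub>n = exp (- \<theta>\<^sup>2 \<sigma>\<^sup>2 H\<^sub>n / 2) + O(\<theta>)\<close> with the harmonic numbers \<open>H\<^sub>n\<close>,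
  and \<open>\<theta> = 1 / sqrt (log n)\<close> gives the limit. Convergence of characteristic functions
  together with tightness yields convergence in law.\<close>

section \<open>Convergence in law from characteristic functions\<close>

text \<open>The free phase \<open>b\<close> makes constants and sines waves as well, so one
  generator is enough; integrals of such functions are determined by the characteristic
  function.\<close>

inductive trig_poly :: "('a::real_inner \<Rightarrow> real) \<Rightarrow> bool" where
  wave: "trig_poly (\<lambda>x. a * cos (t \<bullet> x + b))"
| add: "trig_poly f \<Longrightarrow> trig_poly g \<Longrightarrow> trig_poly (\<lambda>x. f x + g x)"

lemma trig_poly_const: "trig_poly (\<lambda>x. c)"
  using trig_poly.wave[of c 0 0] by simp

text \<open>Product-to-sum formula: two waves multiply to waves at the difference and the sum of
  their frequencies, so trigonometric polynomials form an algebra.\<close>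

lemma trig_poly_wave_mult:
  assumes "trig_poly f"
  shows "trig_poly (\<lambda>x. a * cos (t \<bullet> x + b) * f x)"
  using assms
proof induction
  case (wave a' t' b')
  have "trig_poly (\<lambda>x. a * a' / 2 * cos ((t - t') \<bullet> x + (b - b')) + a * a' / 2 * cos ((t + t') \<bullet> x + (b + b')))"
    by (intro trig_poly.intros)
  also have "(\<lambda>x. a * a' / 2 * cos ((t - t') \<bullet> x + (b - b')) + a * a' / 2 * cos ((t + t') \<bullet> x + (b + b')))
      = (\<lambda>x. a * cos (t \<bullet> x + b) * (a' * cos (t' \<bullet> x + b')))"
  proof
    fix x
    have "cos (t \<bullet> x + b) * cos (t' \<bullet> x + b')
        = (cos ((t - t') \<bullet> x + (b - b')) + cos ((t + t') \<bullet> x + (b + b'))) / 2"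
      by (simp add: cos_times_cos inner_left_distrib inner_diff_left algebra_simps)
    then show "a * a' / 2 * cos ((t - t') \<bullet> x + (b - b')) + a * a' / 2 * cos ((t + t') \<bullet> x + (b + b'))
        = a * cos (t \<bullet> x + b) * (a' * cos (t' \<bullet> x + b'))"
      by (simp add: field_simps)
  qed
  finally show ?case .
next
  case (add f g)
  then show ?case
    using trig_poly.add[OF add.IH] by (simp add: distrib_left)
qed

lemma trig_poly_mult:
  assumes "trig_poly f" "trig_poly g"
  shows "trig_poly (\<lambda>x. f x * g x)"
  using assms(1)
proof induction
  case (wave a t b)
  show ?case by (rule trig_poly_wave_mult[OF assms(2)])
next
  case (add f1 f2)
  then show ?case
    using trig_poly.add[OF add.IH] by (simp add: distrib_right)
qed

lemma trig_poly_sum: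
  assumes "finite A" "\<And>i. i \<in> A \<Longrightarrow> trig_poly (f i)"
  shows "trig_poly (\<lambda>x. \<Sum>i\<in>A. f i x)"
  using assms by (induction A rule: finite_induct) (auto intro: trig_poly_const trig_poly.add)

text \<open>A sine of a coordinate is a wave with phase -pi/2, and the algebra property carries this
  through the construction of the polynomial.\<close>

lemma real_polynomial_function_sines_trig_poly:
  fixes q :: "real ^ 'n \<Rightarrow> real"
  assumes "real_polynomial_function q"
  shows "trig_poly (\<lambda>x :: real ^ 'n. q (\<chi> i. sin (w * x $ i)))"
  using assms
proof induction
  case (linear l)
  have "l (\<chi> i. sin (w * x $ i)) = (\<Sum>i\<in>UNIV. l (axis i 1) * cos ((w *\<^sub>R axis i 1) \<bullet> x + (- pi / 2)))"
    for x :: "real ^ 'n"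
  proof -
    have "(\<chi> i. sin (w * x $ i)) = (\<Sum>i\<in>UNIV. sin (w * x $ i) *\<^sub>R (axis i 1 :: real ^ 'n))"
      by (simp add: vec_eq_iff axis_def if_distrib[of "(*\<^sub>R) _"] if_distrib[of "(*) _"] cong: if_cong)
    then have "l (\<chi> i. sin (w * x $ i)) = (\<Sum>i\<in>UNIV. sin (w * x $ i) * l (axis i 1))"
      using linear by (simp add: linear_sum linear_scale bounded_linear.linear)
    also have "\<dots> = (\<Sum>i\<in>UNIV. l (axis i 1) * cos ((w *\<^sub>R axis i 1) \<bullet> x + (- pi / 2)))"
      by (intro sum.cong) (auto simp: inner_axis' cos_sin_eq)
    finally show ?thesis .
  qed
  then show ?case
    by (simp only:) (intro trig_poly_sum trig_poly.wave; simp)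
next
  case (const c)
  show ?case by (rule trig_poly_const)
qed (auto intro: trig_poly.add trig_poly_mult)

lemma trig_poly_continuous: "trig_poly f \<Longrightarrow> continuous_on A f"
  by (induction rule: trig_poly.induct) (auto intro!: continuous_intros)

lemma trig_poly_bounded: "trig_poly f \<Longrightarrow> \<exists>B. \<forall>x. \<bar>f x\<bar> \<le> B"
proof (induction rule: trig_poly.induct)
  case (wave a t b)
  show ?case
    by (intro exI[of _ "\<bar>a\<bar>"]) (simp add: abs_mult mult_left_le)
next
  case (add f g)
  then obtain B C where "\<forall>x. \<bar>f x\<bar> \<le> B" "\<forall>x. \<bar>g x\<bar> \<le> C" by blast
  then have "\<forall>x. \<bar>f x + g x\<bar> \<le> B + C" by (meson abs_triangle_ineq add_mono order_trans)
  then show ?case by blast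
qed

section \<open>Integrals of trigonometric polynomials under converging characteristic
  functions\<close>

lemma integrable_bounded_continuous:
  fixes f :: "'a::{second_countable_topology,t2_space} \<Rightarrow> 'b::{banach,second_countable_topology}"
  assumes "prob_space M" "(\<lambda>x. x) \<in> M \<rightarrow>\<^sub>M borel" "continuous_on UNIV f" "\<And>x. norm (f x) \<le> B"
  shows "integrable M f"
proof -
  interpret prob_space M by fact
  have "f \<in> borel_measurable borel"
    using assms(3) by (rule borel_measurable_continuous_onI)
  then have "f \<in> borel_measurable M"
    using measurable_compose[OF assms(2)] by blast
  then show ?thesis
    using assms(4) by (intro integrable_const_bound[of _ B]) auto
qed

text \<open>The integral of a wave is the real part of a rotated value of the characteristic
  function. Measurability of the identity is asked instead of equality with the Borel sets, because
  laws that come from a pmf carry the discrete sigma-algebra.\<close>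

lemma integral_trig_poly_tendsto:
  fixes M :: "nat \<Rightarrow> ('a::euclidean_space) measure"
  assumes M: "\<And>n. prob_space (M n)" "\<And>n. (\<lambda>x. x) \<in> M n \<rightarrow>\<^sub>M borel"
    and L: "prob_space L" "(\<lambda>x. x) \<in> L \<rightarrow>\<^sub>M borel"
    and char: "\<And>t. (\<lambda>n. \<integral>x. cis (t \<bullet> x) \<partial>M n) \<longlonglongrightarrow> (\<integral>x. cis (t \<bullet> x) \<partial>L)"
    and f: "trig_poly f"
  shows "(\<lambda>n. \<integral>x. f x \<partial>M n) \<longlonglongrightarrow> (\<integral>x. f x \<partial>L)"
  using f
proof induction
  case (wave a t b)
  have *: "(\<integral>x. a * cos (t \<bullet> x + b) \<partial>N) = a * Re (cis b * (\<integral>x. cis (t \<bullet> x) \<partial>N))"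
    if "prob_space N" "(\<lambda>x. x) \<in> N \<rightarrow>\<^sub>M borel" for N :: "'a measure"
  proof -
    have "integrable N (\<lambda>x. cis (t \<bullet> x))"
      using that by (intro integrable_bounded_continuous[where B = 1]) (auto intro!: continuous_intros)
    then have "Re (cis b * (\<integral>x. cis (t \<bullet> x) \<partial>N)) = (\<integral>x. Re (cis b * cis (t \<bullet> x)) \<partial>N)"
      by (subst integral_mult_right_zero[symmetric], subst integral_Re) auto
    also have "\<dots> = (\<integral>x. cos (t \<bullet> x + b) \<partial>N)"
      by (intro Bochner_Integration.integral_cong) (auto simp: cis_mult add_ac)
    finally show ?thesis by simp
  qed
  show ?case
    unfolding *[OF M] *[OF L] by (intro tendsto_intros char)
next
  case (add f g)
  have *: "(\<integral>x. f x + g x \<partial>N) = (\<integral>x. f x \<partial>N) + (\<integral>x. g x \<partial>N)"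
    if "prob_space N" "(\<lambda>x. x) \<in> N \<rightarrow>\<^sub>M borel" for N
  proof (rule Bochner_Integration.integral_add)
    show "integrable N f" "integrable N g"
      using that add.hyps trig_poly_bounded trig_poly_continuous
      by (metis integrable_bounded_continuous real_norm_def)+
  qed
  show ?case
    unfolding *[OF M] *[OF L] by (intro tendsto_intros add.IH)
qed

text \<open>Intended for \<open>A\<close> the complement of a large cube: the approximation is good
  inside, and outside only sup bounds are available, at the price of the mass of
  \<open>A\<close>.\<close>

lemma expectation_close:
  fixes f g :: "'a \<Rightarrow> real"
  assumes "prob_space M" "integrable M f" "integrable M g" "A \<in> sets M"
    and "\<And>x. x \<in> space M \<Longrightarrow> x \<notin> A \<Longrightarrow> \<bar>f x - g x\<bar> \<le> e"
    and "\<And>x. \<bar>f x - g x\<bar> \<le> B + e" "0 \<le> e"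
  shows "\<bar>(\<integral>x. f x \<partial>M) - (\<integral>x. g x \<partial>M)\<bar> \<le> e + B * measure M A"
proof -
  interpret prob_space M by fact
  have int: "integrable M (\<lambda>x. e + B * indicator A x)"
    using assms(4) by (auto simp: emeasure_eq_measure)
  have "\<bar>(\<integral>x. f x \<partial>M) - (\<integral>x. g x \<partial>M)\<bar> = \<bar>\<integral>x. f x - g x \<partial>M\<bar>"
    using assms by simp
  also have "\<dots> \<le> (\<integral>x. \<bar>f x - g x\<bar> \<partial>M)"
    by (rule integral_abs_bound)
  also have "\<dots> \<le> (\<integral>x. e + B * indicator A x \<partial>M)"
    using assms by (intro integral_mono int) (auto simp: indicator_def add.commute)
  also have "\<dots> = e + B * measure M A"
    using assms(4) by (subst Bochner_Integration.integral_add) (auto simp: prob_space emeasure_eq_measure)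
  finally show ?thesis .
qed

text \<open>A bounded continuous \<open>f\<close> is replaced by its folding along the triangle wave
  \<open>x \<mapsto> (2R/\<pi>) arcsin (sin (\<pi>x/2R))\<close> in each coordinate: the result agrees with \<open>f\<close> on the cube
  of radius \<open>R\<close>, and by Stone-Weierstrass it is a uniform limit of polynomials in sines.\<close>

theorem conv_in_law_if_char_tendsto:
  fixes M :: "nat \<Rightarrow> (real ^ 'n) measure"
  assumes M: "\<And>n. prob_space (M n)" "\<And>n. (\<lambda>x. x) \<in> M n \<rightarrow>\<^sub>M borel"
    and spM: "\<And>n. space (M n) = UNIV"
    and L: "prob_space L" "sets L = sets borel"
    and char: "\<And>t. (\<lambda>n. \<integral>x. cis (t \<bullet> x) \<partial>M n) \<longlonglongrightarrow> (\<integral>x. cis (t \<bullet> x) \<partial>L)"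
    and tight: "\<And>e. e > 0 \<Longrightarrow> \<exists>R>0. \<forall>\<^sub>F n in sequentially. measure (M n) {x. \<exists>i. R < \<bar>x $ i\<bar>} < e"
  shows "conv_in_law M L"
  unfolding conv_in_law_def
proof (intro allI impI)
  fix f :: "real ^ 'n \<Rightarrow> real"
  assume cont: "continuous_on UNIV f" and "bounded (range f)"
  then obtain B where B: "B > 0" "\<And>x. \<bar>f x\<bar> \<le> B"
    unfolding bounded_pos by auto
  have Lm: "(\<lambda>x. x) \<in> L \<rightarrow>\<^sub>M borel"
    using L(2) by (simp add: measurable_ident_sets)
  have spL: "space L = UNIV"
    using L(2) sets_eq_imp_space_eq by fastforce
  interpret L: prob_space L by fact
  define out where "out R = {x :: real ^ 'n. \<exists>i. R < \<bar>x $ i\<bar>}" for R :: real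
  have out_open: "open (out R)" for R
  proof -
    have "out R = (\<Union>i. {x. R < \<bar>x $ i\<bar>})" by (auto simp: out_def)
    then show ?thesis by (auto intro!: open_Collect_less continuous_intros)
  qed
  have out_sets: "out R \<in> sets N" if "(\<lambda>x. x) \<in> N \<rightarrow>\<^sub>M borel" "space N = UNIV" for R N
    using measurable_sets[OF that(1), of "out R"] out_open[of R] that(2) by auto
  have out_mono: "out R' \<subseteq> out R" if "R \<le> R'" for R R'
    using that unfolding out_def by (blast intro: le_less_trans)
  show "(\<lambda>n. integral\<^sup>L (M n) f) \<longlonglongrightarrow> integral\<^sup>L L f"
  proof (rule LIMSEQ_I)
    fix e0 :: real assume "e0 > 0"
    \<comment> \<open>Replacing \<open>f\<close> by a trigonometric polynomial costs 2e for
      \<open>M n\<close> and 2e for \<open>L\<close>, and convergence of the polynomial integrals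
      less than e; the sum 5e is below e0.\<close>
    define e where "e = e0 / 7"
    have e: "e > 0" using \<open>e0 > 0\<close> by (simp add: e_def)
    \<comment> \<open>Outside the cube the two functions differ by at most 2B + e, so mass below e /
      (2B) adds at most e to the uniform error.\<close>
    have small: "e / (2 * B) > 0" using e B by simp
    obtain R1 where R1: "R1 > 0" "\<forall>\<^sub>F n in sequentially. measure (M n) (out R1) < e / (2 * B)"
      using tight[OF small] unfolding out_def by blast
    \<comment> \<open>The single law \<open>L\<close> is tight by continuity from above, since the
      cubes exhaust the space.\<close>
    have "(\<lambda>k. measure L (out (real k))) \<longlonglongrightarrow> measure L (\<Inter>k. out (real k))"
      using out_sets[OF Lm spL]
      by (intro L.finite_Lim_measure_decseq) (auto simp: decseq_def intro!: out_mono)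
    also have "(\<Inter>k. out (real k)) = {}"
    proof -
      have "\<exists>k. x \<notin> out (real k)" for x
      proof -
        obtain k where "norm x \<le> real k" using real_arch_simple by blast
        then have "\<bar>x $ i\<bar> \<le> real k" for i
          using component_le_norm_cart[of x i] by linarith
        then show ?thesis unfolding out_def by (auto simp: not_less)
      qed
      then show ?thesis by blast
    qed
    finally have "\<forall>\<^sub>F k in sequentially. measure L (out (real k)) < e / (2 * B)"
      using small by (auto intro: order_tendstoD)
    then obtain k where k: "measure L (out (real k)) < e / (2 * B)"
      by (auto simp: eventually_sequentially)
    define R where "R = max R1 (real k)"
    have R: "R > 0" using R1 by (simp add: R_def)
    have tailL: "measure L (out R) < e / (2 * B)"
      using L.finite_measure_mono[OF out_mono[of "real k" R] out_sets[OF Lm spL]] k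
      by (simp add: R_def)
    have tailM: "\<forall>\<^sub>F n in sequentially. measure (M n) (out R) < e / (2 * B)"
      using R1(2)
    proof eventually_elim
      case (elim n)
      interpret prob_space "M n" by (rule M)
      show ?case
        using finite_measure_mono[OF out_mono[of R1 R] out_sets[OF M(2) spM]] elim
        by (simp add: R_def)
    qed
    \<comment> \<open>\<open>h\<close> is the folded function in the coordinates y = sin (w x),
      where it lives on a compact cube. The frequency w = pi / (2R) makes arcsin undo the sine
      exactly for coordinates in [-R, R].\<close>
    define h where "h y = f (\<chi> i. 2 * R / pi * arcsin (y $ i))" for y :: "real ^ 'n"
    define w where "w = pi / (2 * R)"
    have wp: "w > 0" using R by (simp add: w_def)
    have "continuous_on (cbox (\<chi> i. -1) (\<chi> i. 1)) h"
      unfolding h_def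
      by (rule continuous_on_compose2[OF cont]) (auto intro!: continuous_intros simp: mem_box_cart)
    then obtain q where q: "real_polynomial_function q"
        "\<And>y. y \<in> cbox (\<chi> i. -1) (\<chi> i. 1) \<Longrightarrow> \<bar>h y - q y\<bar> < e"
      using Stone_Weierstrass_real_polynomial_function[OF compact_cbox _ e] by metis
    define P where "P x = q (\<chi> i. sin (w * x $ i))" for x :: "real ^ 'n"
    have P: "trig_poly P"
      unfolding P_def by (rule real_polynomial_function_sines_trig_poly[OF q(1)])
    have hP: "\<bar>h (\<chi> i. sin (w * x $ i)) - P x\<bar> < e" for x
      unfolding P_def by (intro q) (auto simp: mem_box_cart)
    have inside: "\<bar>f x - P x\<bar> \<le> e" if "x \<notin> out R" for x
    proof -
      have "2 * R / pi * arcsin (sin (w * x $ i)) = x $ i" for i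
      proof -
        have "\<bar>x $ i\<bar> \<le> R" using that by (force simp: out_def not_less)
        then have "w * \<bar>x $ i\<bar> \<le> w * R"
          using wp by (intro mult_left_mono) auto
        also have "w * R = pi / 2"
          using R by (simp add: w_def)
        finally have "\<bar>w * x $ i\<bar> \<le> pi / 2"
          using wp by (simp add: abs_mult)
        then have "arcsin (sin (w * x $ i)) = w * x $ i"
          by (intro arcsin_sin) auto
        then show ?thesis using R by (simp add: w_def)
      qed
      then have "h (\<chi> i. sin (w * x $ i)) = f x"
        by (simp add: h_def)
      then show ?thesis using hP[of x] by simp
    qed
    \<comment> \<open>Folding only moves the argument of \<open>f\<close>, so the bound B survives
      outside the cube.\<close>
    have outside: "\<bar>f x - P x\<bar> \<le> 2 * B + e" for x
      using hP[of x] B(2)[of x] B(2)[of "\<chi> i. 2 * R / pi * arcsin (sin (w * x $ i))"]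
      unfolding h_def by simp
    obtain C where C: "\<And>x. \<bar>P x\<bar> \<le> C" using trig_poly_bounded[OF P] by blast
    have close: "\<bar>(\<integral>x. f x \<partial>N) - (\<integral>x. P x \<partial>N)\<bar> \<le> 2 * e"
      if "prob_space N" "(\<lambda>x. x) \<in> N \<rightarrow>\<^sub>M borel" "space N = UNIV" "measure N (out R) < e / (2 * B)" for N
    proof -
      have "\<bar>(\<integral>x. f x \<partial>N) - (\<integral>x. P x \<partial>N)\<bar> \<le> e + 2 * B * measure N (out R)"
        using that inside outside e
        by (intro expectation_close out_sets integrable_bounded_continuous[OF _ _ cont, of _ B]
              integrable_bounded_continuous[OF _ _ trig_poly_continuous[OF P], of _ C])
          (auto simp: B C)
      also have "2 * B * measure N (out R) \<le> e"
        using that(4) B by (simp add: field_simps)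
      finally show ?thesis by simp
    qed
    have "(\<lambda>n. \<integral>x. P x \<partial>M n) \<longlonglongrightarrow> (\<integral>x. P x \<partial>L)"
      by (rule integral_trig_poly_tendsto[OF M L(1) Lm char P])
    then have "\<forall>\<^sub>F n in sequentially. \<bar>(\<integral>x. P x \<partial>M n) - (\<integral>x. P x \<partial>L)\<bar> < e"
      using e by (auto simp: tendsto_iff dist_real_def)
    with tailM have "\<forall>\<^sub>F n in sequentially. norm (integral\<^sup>L (M n) f - integral\<^sup>L L f) < e0"
    proof eventually_elim
      case (elim n)
      show ?case
        using close[OF M spM elim(1)] close[OF L(1) Lm spL tailL] elim(2) \<open>e0 > 0\<close>
        unfolding e_def real_norm_def by linarith
    qed
    then show "\<exists>no. \<forall>n\<ge>no. norm (integral\<^sup>L (M n) f - integral\<^sup>L L f) < e0"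
      by (simp add: eventually_sequentially)
  qed
qed

section \<open>The isotropic Gaussian law\<close>

text \<open>Fubini. \<open>lborel\<close> is the image of a product measure indexed by basis
  vectors, so coordinates must be matched with the vectors \<open>axis i 1\<close>; \<open>c\<close>
  inverts this matching.\<close>

lemma integral_lborel_vec_prod:
  fixes h :: "'n::finite \<Rightarrow> real \<Rightarrow> 'b::{real_normed_field,banach,second_countable_topology}"
  assumes "\<And>i. integrable lborel (h i)"
  shows "(\<integral>x. (\<Prod>i\<in>UNIV. h i (x $ i)) \<partial>(lborel :: (real ^ 'n) measure)) = (\<Prod>i\<in>UNIV. \<integral>x. h i x \<partial>lborel)"
proof -
  interpret product_sigma_finite "\<lambda>b :: real ^ 'n. lborel :: real measure"
    by unfold_locales
  have [measurable]: "h i \<in> borel_measurable borel" for i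
    using borel_measurable_integrable[OF assms[of i]] by simp
  have inj: "inj (\<lambda>i::'n. axis i (1::real))"
    by (auto simp: inj_def axis_eq_axis)
  have Basis: "(Basis :: (real ^ 'n) set) = range (\<lambda>i. axis i 1)"
    by (auto simp: Basis_vec_def)
  define c :: "real ^ 'n \<Rightarrow> 'n" where "c b = (THE i. b = axis i 1)" for b
  have c: "c (axis i 1) = i" for i
    unfolding c_def by (rule the_equality) (auto simp: axis_eq_axis)
  have "(\<integral>x. (\<Prod>i\<in>UNIV. h i (x $ i)) \<partial>(lborel :: (real ^ 'n) measure))
      = (\<integral>f. (\<Prod>i\<in>UNIV. h i ((\<Sum>b\<in>Basis. f b *\<^sub>R b) $ i)) \<partial>(\<Pi>\<^sub>M b\<in>(Basis :: (real ^ 'n) set). lborel))"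
    by (subst lborel_eq, subst integral_distr) auto
  also have "\<dots> = (\<integral>f. (\<Prod>b\<in>Basis. h (c b) (f b)) \<partial>(\<Pi>\<^sub>M b\<in>(Basis :: (real ^ 'n) set). lborel))"
  proof (intro Bochner_Integration.integral_cong refl)
    fix f :: "real ^ 'n \<Rightarrow> real"
    have "(\<Sum>b\<in>Basis. f b *\<^sub>R b) $ i = f (axis i 1)" for i
    proof -
      have "(\<Sum>b\<in>Basis. f b *\<^sub>R b) $ i = (\<Sum>j\<in>UNIV. if j = i then f (axis j 1) else 0)"
        unfolding Basis sum_component sum.reindex[OF inj] by (intro sum.cong) (auto simp: axis_def)
      then show ?thesis by simp
    qed
    then show "(\<Prod>i\<in>UNIV. h i ((\<Sum>b\<in>Basis. f b *\<^sub>R b) $ i)) = (\<Prod>b\<in>Basis. h (c b) (f b))"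
      by (simp add: Basis prod.reindex[OF inj] c)
  qed
  also have "\<dots> = (\<Prod>b\<in>(Basis :: (real ^ 'n) set). \<integral>x. h (c b) x \<partial>lborel)"
    by (rule product_integral_prod) (auto simp: assms)
  also have "\<dots> = (\<Prod>i\<in>UNIV. \<integral>x. h i x \<partial>lborel)"
    by (simp add: Basis prod.reindex[OF inj] c)
  finally show ?thesis .
qed

text \<open>Rescaling by \<sigma> reduces this to the known characteristic function of the standard
  normal law.\<close>

lemma char_normal_density:
  assumes "\<sigma> > 0"
  shows "(\<integral>x. complex_of_real (normal_density 0 \<sigma> x) * cis (u * x) \<partial>lborel) = exp (- ((\<sigma> * u)\<^sup>2) / 2)"
proof -
  have "(\<integral>x. complex_of_real (normal_density 0 \<sigma> x) * cis (u * x) \<partial>lborel)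
      = \<sigma> *\<^sub>R (\<integral>x. complex_of_real (normal_density 0 \<sigma> (\<sigma> * x)) * cis (u * (\<sigma> * x)) \<partial>lborel)"
    using assms
      lborel_integral_real_affine[of \<sigma> "\<lambda>x. complex_of_real (normal_density 0 \<sigma> x) * cis (u * x)" 0]
    by simp
  also have "\<dots> = (\<integral>x. \<sigma> *\<^sub>R (complex_of_real (normal_density 0 \<sigma> (\<sigma> * x)) * cis (u * (\<sigma> * x))) \<partial>lborel)"
    by simp
  also have "\<dots> = (\<integral>x. std_normal_density x *\<^sub>R iexp (\<sigma> * u * x) \<partial>lborel)"
  proof (intro Bochner_Integration.integral_cong refl)
    fix x
    have "\<sigma> * normal_density 0 \<sigma> (\<sigma> * x) = std_normal_density x"
      using assms by (simp add: normal_density_def power_mult_distrib real_sqrt_mult)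
    then have "complex_of_real \<sigma> * complex_of_real (normal_density 0 \<sigma> (\<sigma> * x)) = complex_of_real (std_normal_density x)"
      by (metis of_real_mult)
    then show "\<sigma> *\<^sub>R (complex_of_real (normal_density 0 \<sigma> (\<sigma> * x)) * cis (u * (\<sigma> * x)))
        = std_normal_density x *\<^sub>R iexp (\<sigma> * u * x)"
      by (simp add: scaleR_conv_of_real cis_conv_exp mult_ac)
  qed
  also have "\<dots> = char std_normal_distribution (\<sigma> * u)"
    unfolding char_def by (subst integral_density) auto
  also have "\<dots> = exp (- ((\<sigma> * u)\<^sup>2) / 2)"
    by (simp add: char_std_normal_distribution)
  finally show ?thesis .
qed

lemma integral_gauss_iso_prod:
  fixes h :: "'n::finite \<Rightarrow> real \<Rightarrow> complex"
  assumes "s > 0" and [measurable]: "\<And>i. h i \<in> borel_measurable borel" and "\<And>i x. norm (h i x) \<le> 1"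
  shows "(\<integral>x. (\<Prod>i\<in>UNIV. h i (x $ i)) \<partial>(gauss_iso s :: (real ^ 'n) measure))
    = (\<Prod>i\<in>UNIV. \<integral>x. complex_of_real (normal_density 0 (sqrt s) x) * h i x \<partial>lborel)"
proof -
  have int: "integrable lborel (\<lambda>x. complex_of_real (normal_density 0 (sqrt s) x) * h i x)" for i
    using assms
    by (intro Bochner_Integration.integrable_bound[OF integrable_normal_density[of "sqrt s" 0]])
      (auto simp: norm_mult mult_left_le)
  have "(\<integral>x. (\<Prod>i\<in>UNIV. h i (x $ i)) \<partial>(gauss_iso s :: (real ^ 'n) measure))
      = (\<integral>x. (\<Prod>i\<in>UNIV. normal_density 0 (sqrt s) (x $ i)) *\<^sub>R (\<Prod>i\<in>UNIV. h i (x $ i)) \<partial>(lborel :: (real ^ 'n) measure))"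
    unfolding gauss_iso_def by (subst integral_density) (auto intro!: prod_nonneg)
  also have "\<dots> = (\<integral>x. (\<Prod>i\<in>UNIV. complex_of_real (normal_density 0 (sqrt s) (x $ i)) * h i (x $ i)) \<partial>(lborel :: (real ^ 'n) measure))"
    by (simp add: scaleR_conv_of_real prod.distrib)
  also have "\<dots> = (\<Prod>i\<in>UNIV. \<integral>x. complex_of_real (normal_density 0 (sqrt s) x) * h i x \<partial>lborel)"
    by (rule integral_lborel_vec_prod[OF int])
  finally show ?thesis .
qed

lemma sets_gauss_iso: "sets (gauss_iso s :: (real ^ 'n::finite) measure) = sets borel"
  by (simp add: gauss_iso_def)

lemma prob_space_gauss_iso:
  assumes "s > 0"
  shows "prob_space (gauss_iso s :: (real ^ 'n::finite) measure)"
proof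
  have inj: "inj (\<lambda>i::'n. axis i (1::real))"
    by (auto simp: inj_def axis_eq_axis)
  have Basis: "(Basis :: (real ^ 'n) set) = range (\<lambda>i. axis i 1)"
    by (auto simp: Basis_vec_def)
  have "emeasure (gauss_iso s :: (real ^ 'n) measure) (space (gauss_iso s))
      = (\<integral>\<^sup>+x. ennreal (\<Prod>i\<in>UNIV. normal_density 0 (sqrt s) (x $ i)) \<partial>(lborel :: (real ^ 'n) measure))"
    unfolding gauss_iso_def by (subst emeasure_density) auto
  also have "\<dots> = (\<integral>\<^sup>+x. (\<Prod>b\<in>Basis. ennreal (normal_density 0 (sqrt s) (x \<bullet> b))) \<partial>(lborel :: (real ^ 'n) measure))"
    by (simp add: prod_ennreal Basis prod.reindex[OF inj] inner_axis)
  also have "\<dots> = (\<Prod>b\<in>(Basis :: (real ^ 'n) set). \<integral>\<^sup>+x. ennreal (normal_density 0 (sqrt s) x) \<partial>lborel)"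
    by (rule nn_integral_lborel_prod) auto
  also have "\<dots> = 1"
    using assms by (subst nn_integral_eq_integral) auto
  finally show "emeasure (gauss_iso s :: (real ^ 'n) measure) (space (gauss_iso s)) = 1" .
qed

lemma char_gauss_iso:
  fixes t :: "real ^ 'n::finite"
  assumes "s > 0"
  shows "(\<integral>x. cis (t \<bullet> x) \<partial>gauss_iso s) = exp (- (s * (norm t)\<^sup>2 / 2))"
proof -
  have cis_sum: "cis (\<Sum>i\<in>A. f i) = (\<Prod>i\<in>A. cis (f i))" if "finite A" for A :: "'n set" and f
    using that by (induction A rule: finite_induct) (auto simp: cis_mult[symmetric])
  have "(\<integral>x. cis (t \<bullet> x) \<partial>gauss_iso s) = (\<integral>x. (\<Prod>i\<in>UNIV. cis (t $ i * x $ i)) \<partial>gauss_iso s)"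
    by (simp add: inner_vec_def cis_sum)
  also have "\<dots> = (\<Prod>i\<in>UNIV. complex_of_real (exp (- ((sqrt s * t $ i)\<^sup>2) / 2)))"
    using assms
    by (subst integral_gauss_iso_prod)
      (auto simp: char_normal_density intro!: borel_measurable_continuous_onI continuous_intros)
  also have "\<dots> = complex_of_real (exp (\<Sum>i\<in>UNIV. - ((sqrt s * t $ i)\<^sup>2) / 2))"
    by (simp add: exp_sum)
  also have "(\<Sum>i\<in>UNIV. - ((sqrt s * t $ i)\<^sup>2) / 2) = - (s * (norm t)\<^sup>2 / 2)"
    using assms
    by (simp add: power2_norm_eq_inner inner_vec_def power_mult_distrib sum_distrib_left sum_divide_distrib sum_negf power2_eq_square[of "t $ _"])
  finally show ?thesis .
qed

section \<open>The step kernel of the elephant random walk\<close>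

lemma erw_dirs_eq: "(erw_dirs :: (real ^ 'd::finite) set) = range (\<lambda>i. axis i 1) \<union> range (\<lambda>i. axis i (-1))"
  by (auto simp: erw_dirs_def)

lemma finite_erw_dirs: "finite (erw_dirs :: (real ^ 'd::finite) set)"
  by (simp add: erw_dirs_eq)

lemma sum_erw_dirs:
  fixes f :: "real ^ 'd::finite \<Rightarrow> 'b::comm_monoid_add"
  shows "(\<Sum>v\<in>erw_dirs. f v) = (\<Sum>i\<in>UNIV. f (axis i 1) + f (axis i (-1)))"
proof -
  have inj: "inj (\<lambda>i::'d. axis i c)" if "c \<noteq> 0" for c :: real
    using that by (auto simp: inj_def axis_eq_axis)
  have "range (\<lambda>i::'d. axis i 1) \<inter> range (\<lambda>i. axis i (-1::real)) = {}"
    by (auto simp: axis_eq_axis)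
  then show ?thesis
    unfolding erw_dirs_eq by (simp add: sum.union_disjoint sum.reindex[OF inj] sum.distrib)
qed

lemma card_erw_dirs: "card (erw_dirs :: (real ^ 'd::finite) set) = 2 * CARD('d)"
  using sum_erw_dirs[of "\<lambda>_::real ^ 'd. 1 :: nat"] by simp

lemma erw_dirs_nonempty: "(erw_dirs :: (real ^ 'd::finite) set) \<noteq> {}"
  by (auto simp: erw_dirs_def)

lemma norm_erw_dirs: "v \<in> erw_dirs \<Longrightarrow> norm v = 1"
  by (auto simp: erw_dirs_def norm_eq_1 inner_axis)

text \<open>Even in dimension one there are two directions, so the uniform choice among the
  remaining ones is always from a nonempty set.\<close>

lemma erw_dirs_diff_nonempty: "(erw_dirs :: (real ^ 'd::finite) set) - {y} \<noteq> {}"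
proof
  assume "(erw_dirs :: (real ^ 'd) set) - {y} = {}"
  then have "card (erw_dirs :: (real ^ 'd) set) \<le> card {y}"
    by (intro card_mono) auto
  moreover have "CARD('d) > 0" by simp
  ultimately show False by (simp only: card_erw_dirs card.insert finite.emptyI) simp
qed

lemma set_pmf_erw_dirs_diff: "set_pmf (pmf_of_set (erw_dirs - {y :: real ^ 'd::finite})) = erw_dirs - {y}"
  by (rule set_pmf_of_set[OF erw_dirs_diff_nonempty finite_Diff[OF finite_erw_dirs]])

lemma sum_erw_dirs_inner: "(\<Sum>v\<in>erw_dirs. t \<bullet> v) = 0"
  by (simp add: sum_erw_dirs inner_axis)

text \<open>Each axis counts twice. Divided by the 2d directions this is the variance |t|^2 / d of a
  uniform direction along t.\<close>

lemma sum_erw_dirs_inner_square: "(\<Sum>v\<in>erw_dirs. (t \<bullet> v)\<^sup>2) = 2 * (norm t)\<^sup>2"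
proof -
  have "(\<Sum>v\<in>erw_dirs. (t \<bullet> v)\<^sup>2) = (\<Sum>i\<in>UNIV. 2 * (t $ i)\<^sup>2)"
    by (simp add: sum_erw_dirs inner_axis)
  also have "\<dots> = 2 * (norm t)\<^sup>2"
    by (simp only: power2_norm_eq_inner) (simp add: sum_distrib_left inner_vec_def power2_eq_square)
  finally show ?thesis .
qed

section \<open>Taylor estimates for characteristic functions\<close>

lemma norm_cis_diff: "norm (cis a - cis b) \<le> \<bar>a - b\<bar>"
proof -
  have "cis a - cis b = cis b * (cis (a - b) - 1)"
    by (simp add: algebra_simps cis_mult)
  then have "norm (cis a - cis b) = norm (iexp (a - b) - 1)"
    by (simp add: norm_mult cis_conv_exp)
  also have "\<dots> \<le> \<bar>a - b\<bar>"
    using iexp_approx1[of "a - b" 0] by simp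
  finally show ?thesis .
qed

text \<open>Both sides come from exp y >= 1 + y: at y = -x for the lower one, at y = x and inverted
  for the upper one.\<close>

lemma exp_minus_approx:
  fixes x :: real
  assumes "x \<ge> 0"
  shows "\<bar>exp (- x) - (1 - x)\<bar> \<le> x\<^sup>2"
proof -
  have "exp (- x) \<le> 1 / (1 + x)"
    using exp_ge_add_one_self[of x] assms by (simp add: exp_minus field_simps)
  also have "\<dots> \<le> 1 - x + x\<^sup>2"
    using assms by (simp add: divide_simps algebra_simps power2_eq_square)
  finally show ?thesis
    using exp_ge_add_one_self[of "- x"] by linarith
qed

text \<open>Second order Taylor expansion: centring removes the linear term, and the cubic remainder
  is bounded pointwise.\<close>

lemma char_centered_approx:
  fixes Y :: "'a \<Rightarrow> real"
  assumes fin: "finite (set_pmf K)" and Y0: "measure_pmf.expectation K Y = 0"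
    and b: "\<And>x. x \<in> set_pmf K \<Longrightarrow> \<bar>Y x\<bar> \<le> b" and "l \<ge> 0"
  shows "norm (measure_pmf.expectation K (\<lambda>x. cis (l * Y x))
      - complex_of_real (1 - l\<^sup>2 / 2 * measure_pmf.expectation K (\<lambda>x. (Y x)\<^sup>2))) \<le> (l * b) ^ 3 / 6"
proof -
  note int[simp] = integrable_measure_pmf_finite[OF fin]
  let ?A = "\<lambda>x. 1 + \<i> * complex_of_real (l * Y x) - complex_of_real ((l * Y x)\<^sup>2 / 2)"
  have eq: "measure_pmf.expectation K ?A
      = complex_of_real (1 - l\<^sup>2 / 2 * measure_pmf.expectation K (\<lambda>x. (Y x)\<^sup>2))"
  proof -
    have "measure_pmf.expectation K ?A
        = measure_pmf.expectation K (\<lambda>x. 1)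
          + measure_pmf.expectation K (\<lambda>x. \<i> * complex_of_real (l * Y x))
          - measure_pmf.expectation K (\<lambda>x. complex_of_real ((l * Y x)\<^sup>2 / 2))"
      by (subst Bochner_Integration.integral_diff, simp, simp, subst Bochner_Integration.integral_add) simp_all
    also have "measure_pmf.expectation K (\<lambda>x. \<i> * complex_of_real (l * Y x)) = 0"
      using Y0 by simp
    also have "measure_pmf.expectation K (\<lambda>x. complex_of_real ((l * Y x)\<^sup>2 / 2))
        = complex_of_real (l\<^sup>2 / 2 * measure_pmf.expectation K (\<lambda>x. (Y x)\<^sup>2))"
      by (subst integral_complex_of_real) (simp add: power_mult_distrib)
    finally show ?thesis by simp
  qed
  have pointwise: "norm (cis (l * Y x) - ?A x) \<le> (l * b) ^ 3 / 6" if "x \<in> set_pmf K" for x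
  proof -
    have "{..2::nat} = {0, 1, 2}" by auto
    then have "(\<Sum>k\<le>2. (\<i> * complex_of_real (l * Y x)) ^ k / fact k) = ?A x"
      by (simp add: power_mult_distrib)
    then have "norm (cis (l * Y x) - ?A x) \<le> \<bar>l * Y x\<bar> ^ 3 / 6"
      using iexp_approx1[of "l * Y x" 2] by (simp add: cis_conv_exp eval_nat_numeral)
    also have "\<bar>l * Y x\<bar> ^ 3 \<le> (l * b) ^ 3"
      using b[OF that] \<open>l \<ge> 0\<close> by (intro power_mono) (auto simp: abs_mult intro: mult_left_mono)
    finally show ?thesis by simp
  qed
  have "norm (measure_pmf.expectation K (\<lambda>x. cis (l * Y x)) - measure_pmf.expectation K ?A)
      = norm (measure_pmf.expectation K (\<lambda>x. cis (l * Y x) - ?A x))"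
    by (subst Bochner_Integration.integral_diff) simp_all
  also have "\<dots> \<le> measure_pmf.expectation K (\<lambda>x. norm (cis (l * Y x) - ?A x))"
    by (rule integral_norm_bound)
  also have "\<dots> \<le> measure_pmf.expectation K (\<lambda>x. (l * b) ^ 3 / 6)"
    by (intro integral_mono_AE) (use pointwise in \<open>auto simp: AE_measure_pmf_iff\<close>)
  also have "\<dots> = (l * b) ^ 3 / 6" by simp
  finally show ?thesis unfolding eq .
qed

section \<open>The conditional law of the next step\<close>

definition erw_kernel :: "real \<Rightarrow> (real ^ 'd::finite) list \<Rightarrow> (real ^ 'd) pmf" where
  "erw_kernel p xs =
     do { k \<leftarrow> pmf_of_set {0..<length xs};
          b \<leftarrow> bernoulli_pmf p;
          if b then return_pmf (xs ! k) else pmf_of_set (erw_dirs - {xs ! k}) }"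

lemma erw_steps_Suc:
  assumes "n > 0"
  shows "erw_steps p (Suc n) = erw_steps p n \<bind> (\<lambda>xs. map_pmf (\<lambda>x. xs @ [x]) (erw_kernel p xs))"
  using assms
  by (cases n) (simp_all add: erw_kernel_def map_pmf_def bind_assoc_pmf)

lemma set_erw_kernel:
  fixes xs :: "(real ^ 'd::finite) list"
  assumes "xs \<noteq> []" "set xs \<subseteq> erw_dirs"
  shows "set_pmf (erw_kernel p xs) \<subseteq> erw_dirs"
proof
  fix x assume "x \<in> set_pmf (erw_kernel p xs)"
  then obtain k b where k: "k < length xs"
    and x: "x \<in> set_pmf (if b then return_pmf (xs ! k) else pmf_of_set (erw_dirs - {xs ! k}))"
    using assms by (auto simp: erw_kernel_def)
  then show "x \<in> erw_dirs"
    using assms by (cases b) (auto simp: set_pmf_erw_dirs_diff)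
qed

lemma set_erw_steps:
  "set_pmf (erw_steps p n :: (real ^ 'd::finite) list pmf) \<subseteq> {xs. set xs \<subseteq> erw_dirs \<and> length xs = n}"
proof (induction n)
  case 0
  then show ?case by simp
next
  case (Suc n)
  show ?case
  proof (cases "n = 0")
    case True
    then show ?thesis by (auto simp: finite_erw_dirs erw_dirs_nonempty)
  next
    case False
    show ?thesis
    proof
      fix ys :: "(real ^ 'd) list" assume "ys \<in> set_pmf (erw_steps p (Suc n))"
      then obtain xs x where xs: "xs \<in> set_pmf (erw_steps p n)" and x: "x \<in> set_pmf (erw_kernel p xs)" and ys: "ys = xs @ [x]"
        using False by (auto simp: erw_steps_Suc)
      have "set xs \<subseteq> erw_dirs" "length xs = n" using xs Suc by auto
      moreover have "x \<in> erw_dirs"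
        using set_erw_kernel[of xs p] x calculation False by auto
      ultimately show "ys \<in> {xs. set xs \<subseteq> erw_dirs \<and> length xs = Suc n}"
        using ys by auto
    qed
  qed
qed

text \<open>Finite support makes every function of the path integrable, which settles all
  integrability questions about the walk.\<close>

lemma finite_set_erw_steps: "finite (set_pmf (erw_steps p n :: (real ^ 'd::finite) list pmf))"
  by (rule finite_subset[OF set_erw_steps finite_lists_length_eq[OF finite_erw_dirs]])

lemma integrable_erw_steps:
  fixes F :: "(real ^ 'd::finite) list \<Rightarrow> 'b::{banach,second_countable_topology}"
  shows "integrable (measure_pmf (erw_steps p n)) F"
  by (rule integrable_measure_pmf_finite[OF finite_set_erw_steps])

lemma expectation_erw_steps_mono:
  fixes F G :: "(real ^ 'd::finite) list \<Rightarrow> real"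
  assumes "\<And>xs. set xs \<subseteq> erw_dirs \<Longrightarrow> length xs = n \<Longrightarrow> F xs \<le> G xs"
  shows "measure_pmf.expectation (erw_steps p n) F \<le> measure_pmf.expectation (erw_steps p n) G"
  using assms set_erw_steps[of p n]
  by (intro integral_mono_AE integrable_erw_steps) (auto simp: AE_measure_pmf_iff)

text \<open>The tower property. Integrals over the kernel take the place of conditional expectations
  given the first n steps in all later arguments.\<close>

lemma expectation_erw_steps_Suc:
  fixes F :: "(real ^ 'd::finite) list \<Rightarrow> 'b::{banach,second_countable_topology}"
  assumes "n > 0"
  shows "measure_pmf.expectation (erw_steps p (Suc n)) F
    = measure_pmf.expectation (erw_steps p n) (\<lambda>xs. measure_pmf.expectation (erw_kernel p xs) (\<lambda>x. F (xs @ [x])))"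
proof -
  let ?A = "{xs :: (real ^ 'd) list. set xs \<subseteq> erw_dirs \<and> length xs = n}"
  have fin: "finite ?A" by (rule finite_lists_length_eq[OF finite_erw_dirs])
  have "measure_pmf.expectation (erw_steps p (Suc n)) F
      = (\<Sum>xs\<in>?A. pmf (erw_steps p n) xs *\<^sub>R measure_pmf.expectation (map_pmf (\<lambda>x. xs @ [x]) (erw_kernel p xs)) F)"
    unfolding erw_steps_Suc[OF assms]
  proof (rule pmf_expectation_bind[OF fin _ set_erw_steps])
    fix xs :: "(real ^ 'd) list" assume "xs \<in> ?A"
    then have "set_pmf (erw_kernel p xs) \<subseteq> erw_dirs"
      using assms by (intro set_erw_kernel) auto
    then show "finite (set_pmf (map_pmf (\<lambda>x. xs @ [x]) (erw_kernel p xs)))"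
      using finite_subset finite_erw_dirs by auto
  qed
  also have "\<dots> = measure_pmf.expectation (erw_steps p n) (\<lambda>xs. measure_pmf.expectation (erw_kernel p xs) (\<lambda>x. F (xs @ [x])))"
    using set_erw_steps[of p n] by (subst integral_measure_pmf[OF fin]) auto
  finally show ?thesis .
qed

text \<open>At the critical memory parameter \<open>(1 - p) / (2d - 1) = 1 / (4d)\<close>, so the next step is, with
  equal probability, a uniformly chosen past step or a uniformly chosen direction.\<close>

lemma expectation_erw_kernel:
  fixes xs :: "(real ^ 'd::finite) list" and f :: "real ^ 'd \<Rightarrow> 'b::{banach,second_countable_topology}"
  assumes p: "p = (2 * real CARD('d) + 1) / (4 * real CARD('d))"
    and xs: "xs \<noteq> []" "set xs \<subseteq> erw_dirs"
  shows "measure_pmf.expectation (erw_kernel p xs) f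
    = (1 / (2 * real (length xs))) *\<^sub>R sum_list (map f xs) + (1 / (4 * real CARD('d))) *\<^sub>R (\<Sum>v\<in>erw_dirs. f v)"
proof -
  define c where "c = 1 / (4 * real CARD('d))"
  define S where "S = (\<Sum>v\<in>erw_dirs. f v)"
  have d: "real CARD('d) \<ge> 1"
    by (simp add: Suc_le_eq)
  have *: "0 \<le> (2 * D + 1) / (4 * D) \<and> (2 * D + 1) / (4 * D) \<le> 1
      \<and> (2 * D + 1) / (4 * D) - 1 / (4 * D) = 1 / 2
      \<and> (1 - (2 * D + 1) / (4 * D)) / (2 * D - 1) = 1 / (4 * D)" if "D \<ge> 1" for D :: real
    using that by (auto simp: field_simps)
  have p01: "0 \<le> p" "p \<le> 1" and pc: "p - c = 1 / 2" "(1 - p) / (2 * real CARD('d) - 1) = c"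
    using *[OF d] unfolding p c_def by blast+
  have step: "measure_pmf.expectation (bernoulli_pmf p \<bind>
        (\<lambda>b. if b then return_pmf y else pmf_of_set (erw_dirs - {y}))) f = (1 / 2) *\<^sub>R f y + c *\<^sub>R S"
    if y: "y \<in> erw_dirs" for y
  proof -
    have ne: "erw_dirs - {y} \<noteq> {}" and fin: "finite (erw_dirs - {y})"
      using erw_dirs_diff_nonempty finite_erw_dirs by auto
    have card: "real (card (erw_dirs - {y})) = 2 * real CARD('d) - 1"
      using y finite_erw_dirs d by (simp add: card_Diff_singleton card_erw_dirs of_nat_diff)
    have "measure_pmf.expectation (pmf_of_set (erw_dirs - {y})) f
        = (\<Sum>v\<in>erw_dirs - {y}. (1 / (2 * real CARD('d) - 1)) *\<^sub>R f v)"
      using fin ne by (subst integral_measure_pmf[OF fin]) (auto simp: card intro!: sum.cong)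
    also have "\<dots> = (1 / (2 * real CARD('d) - 1)) *\<^sub>R (S - f y)"
      using y by (simp add: finite_erw_dirs S_def scaleR_sum_right[symmetric] sum_diff1)
    finally have unif: "measure_pmf.expectation (pmf_of_set (erw_dirs - {y})) f
        = (1 / (2 * real CARD('d) - 1)) *\<^sub>R (S - f y)" .
    have "measure_pmf.expectation (bernoulli_pmf p \<bind>
        (\<lambda>b. if b then return_pmf y else pmf_of_set (erw_dirs - {y}))) f
        = p *\<^sub>R f y + (1 - p) *\<^sub>R measure_pmf.expectation (pmf_of_set (erw_dirs - {y})) f"
      using p01 fin ne
      by (subst pmf_expectation_bind[of UNIV]) (auto simp: UNIV_bool add.commute)
    also have "\<dots> = p *\<^sub>R f y + c *\<^sub>R (S - f y)"
      using pc(2) by (simp add: unif)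
    \<comment> \<open>The uniform law on the other directions is completed by y itself, which lowers
      the weight of the remembered step from p to p - c = 1/2.\<close>
    also have "\<dots> = (p - c) *\<^sub>R f y + c *\<^sub>R S"
      by (simp add: algebra_simps)
    finally show ?thesis by (simp add: pc)
  qed
  have "measure_pmf.expectation (erw_kernel p xs) f
      = (\<Sum>k\<in>{0..<length xs}. ((1 / 2) *\<^sub>R f (xs ! k) + c *\<^sub>R S) /\<^sub>R real (length xs))"
  proof -
    have "measure_pmf.expectation (erw_kernel p xs) f
      = (\<Sum>k\<in>{0..<length xs}. measure_pmf.expectation (bernoulli_pmf p \<bind>
        (\<lambda>b. if b then return_pmf (xs ! k) else pmf_of_set (erw_dirs - {xs ! k}))) f /\<^sub>R real (card {0..<length xs}))"
      unfolding erw_kernel_def using xs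
      by (intro pmf_expectation_bind_pmf_of_set) (auto simp: set_pmf_erw_dirs_diff finite_erw_dirs)
    also have "\<dots> = (\<Sum>k\<in>{0..<length xs}. ((1 / 2) *\<^sub>R f (xs ! k) + c *\<^sub>R S) /\<^sub>R real (length xs))"
      using xs by (intro sum.cong refl) (subst step, auto)
    finally show ?thesis .
  qed
  also have "\<dots> = (1 / (2 * real (length xs))) *\<^sub>R (\<Sum>k\<in>{0..<length xs}. f (xs ! k)) + c *\<^sub>R S"
    using xs by (simp add: scaleR_sum_right[symmetric] scaleR_add_right sum.distrib sum_constant_scaleR) (simp add: field_simps)
  also have "(\<Sum>k\<in>{0..<length xs}. f (xs ! k)) = sum_list (map f xs)"
    by (simp add: sum_list_sum_nth)
  finally show ?thesis by (simp add: c_def S_def)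
qed

section \<open>Second moments at the critical parameter\<close>

abbreviation step_sum :: "('a \<Rightarrow> real) \<Rightarrow> 'a list \<Rightarrow> real" where
  "step_sum g xs \<equiv> sum_list (map g xs)"

text \<open>This is T_n; for g the inner product with t it equals n times the centre of mass along
  t, see \<open>inner_erw_bary\<close>.\<close>

definition prefix_sums :: "('a \<Rightarrow> real) \<Rightarrow> 'a list \<Rightarrow> real" where
  "prefix_sums g xs = (\<Sum>k=1..length xs. step_sum g (take k xs))"

lemma prefix_sums_snoc: "prefix_sums g (xs @ [x]) = prefix_sums g xs + step_sum g xs + g x"
  by (simp add: prefix_sums_def)

lemma inner_erw_bary:
  "t \<bullet> erw_bary xs (length xs) = prefix_sums (\<lambda>x. t \<bullet> x) xs / real (length xs)"
proof -
  have "t \<bullet> erw_pos xs k = step_sum (\<lambda>x. t \<bullet> x) (take k xs)" if "k \<le> length xs" for k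
    using that by (simp add: erw_pos_def inner_sum_right sum_list_sum_nth atLeast0LessThan min_absorb2)
  then show ?thesis
    by (simp add: erw_bary_def prefix_sums_def inner_sum_right)
qed

lemma abs_step_sum_le:
  assumes "set xs \<subseteq> A" "\<And>v. v \<in> A \<Longrightarrow> \<bar>g v\<bar> \<le> B"
  shows "\<bar>step_sum g xs\<bar> \<le> real (length xs) * B"
  using assms(1)
proof (induction xs)
  case (Cons x xs)
  then have "\<bar>g x + step_sum g xs\<bar> \<le> B + real (length xs) * B"
    using assms(2)[of x] by (intro order.trans[OF abs_triangle_ineq] add_mono) auto
  then show ?case by (simp add: algebra_simps)
qed simp

text \<open>Crude, but enough to leave a summable power of n in the characteristic function errors.
  It follows by telescoping 1 / sqrt (n + 1) <= 2 sqrt (n + 1) - 2 sqrt n.\<close>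

lemma harm_le_sqrt: "harm n \<le> 2 * sqrt (real n)"
proof (induction n)
  case (Suc n)
  have "sqrt (real n) * sqrt (real n + 1) \<le> real n + 1 / 2"
  proof (rule power2_le_imp_le)
    show "(sqrt (real n) * sqrt (real n + 1))\<^sup>2 \<le> (real n + 1 / 2)\<^sup>2"
      by (simp add: power_mult_distrib) (simp add: power2_eq_square algebra_simps)
  qed simp
  moreover have "sqrt (real n + 1) \<ge> 1" by simp
  ultimately have "1 / sqrt (real n + 1) \<le> 2 * sqrt (real n + 1) - 2 * sqrt (real n)"
    by (simp add: field_simps)
  moreover have "1 / (real n + 1) \<le> 1 / sqrt (real n + 1)"
  proof -
    have "sqrt (real n + 1) * 1 \<le> sqrt (real n + 1) * sqrt (real n + 1)"
      by (intro mult_left_mono) auto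
    then show ?thesis by (intro divide_left_mono) auto
  qed
  ultimately show ?case
    using Suc by (simp add: harm_Suc inverse_eq_divide add.commute)
qed (simp add: harm_def)

text \<open>Weighted AM-GM. With c of the order of a standard deviation it turns a second moment
  bound into a first moment bound of the right order.\<close>

lemma abs_le_half_add: "\<bar>x\<bar> \<le> (c + x\<^sup>2 / c) / 2" if "c > 0" for x c :: real
proof -
  have "0 \<le> (c - \<bar>x\<bar>)\<^sup>2" by simp
  then have "2 * c * \<bar>x\<bar> \<le> c\<^sup>2 + x\<^sup>2"
    by (simp add: power2_diff)
  then show ?thesis using that by (simp add: field_simps power2_eq_square)
qed

lemma power2_le_if_abs_le: "\<bar>x\<bar> \<le> y \<Longrightarrow> x\<^sup>2 \<le> y\<^sup>2" for x y :: real
  by (metis abs_ge_self abs_le_square_iff order_trans)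

section \<open>Drift and second moments of additive functionals\<close>

locale critical_erw =
  fixes p :: real and d :: "'d::finite itself"
  assumes p: "p = (2 * real CARD('d) + 1) / (4 * real CARD('d))"
begin

abbreviation walk :: "nat \<Rightarrow> (real ^ 'd) list pmf" where
  "walk n \<equiv> erw_steps p n"

abbreviation E :: "nat \<Rightarrow> ((real ^ 'd) list \<Rightarrow> 'b::{banach,second_countable_topology}) \<Rightarrow> 'b" where
  "E n \<equiv> measure_pmf.expectation (walk n)"

abbreviation EK :: "(real ^ 'd) list \<Rightarrow> (real ^ 'd \<Rightarrow> 'b::{banach,second_countable_topology}) \<Rightarrow> 'b" where
  "EK xs \<equiv> measure_pmf.expectation (erw_kernel p xs)"

text \<open>Positivity of n is bundled in because the kernel draws from a nonempty past.\<close>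

definition history :: "nat \<Rightarrow> (real ^ 'd) list \<Rightarrow> bool" where
  "history n xs \<longleftrightarrow> n > 0 \<and> length xs = n \<and> set xs \<subseteq> erw_dirs"

lemma E_mono:
  fixes F G :: "(real ^ 'd) list \<Rightarrow> real"
  assumes "n > 0" "\<And>xs. history n xs \<Longrightarrow> F xs \<le> G xs"
  shows "E n F \<le> E n G"
  using assms by (intro expectation_erw_steps_mono) (auto simp: history_def)

lemma integrable_kernel:
  fixes f :: "real ^ 'd \<Rightarrow> 'b::{banach,second_countable_topology}"
  assumes "history n xs"
  shows "integrable (measure_pmf (erw_kernel p xs)) f"
proof (rule integrable_measure_pmf_finite)
  show "finite (set_pmf (erw_kernel p xs))"
    using assms by (intro finite_subset[OF set_erw_kernel finite_erw_dirs]) (auto simp: history_def)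
qed

lemma kernel_dirs: "history n xs \<Longrightarrow> x \<in> set_pmf (erw_kernel p xs) \<Longrightarrow> x \<in> erw_dirs"
  using set_erw_kernel[of xs p] by (auto simp: history_def)

lemma EK_le:
  fixes f :: "real ^ 'd \<Rightarrow> real"
  assumes "history n xs" "\<And>v. v \<in> erw_dirs \<Longrightarrow> f v \<le> C"
  shows "EK xs f \<le> C"
proof -
  have "EK xs f \<le> EK xs (\<lambda>_. C)"
    using kernel_dirs[OF assms(1)] assms(2) integrable_kernel[OF assms(1)]
    by (intro integral_mono_AE) (auto simp: AE_measure_pmf_iff)
  then show ?thesis by simp
qed

text \<open>The uniformly chosen direction contributes nothing, and the uniformly chosen past step,
  taken half of the time, contributes half of the average of g over the past.\<close>

lemma EK_mean_zero:
  fixes g :: "real ^ 'd \<Rightarrow> real"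
  assumes "history n xs" "(\<Sum>v\<in>erw_dirs. g v) = 0"
  shows "EK xs g = step_sum g xs / (2 * real n)"
proof -
  have "EK xs g = (1 / (2 * real (length xs))) *\<^sub>R sum_list (map g xs) + (1 / (4 * real CARD('d))) *\<^sub>R (\<Sum>v\<in>erw_dirs. g v)"
    using assms(1) by (intro expectation_erw_kernel[OF p]) (auto simp: history_def)
  then show ?thesis using assms by (simp add: history_def)
qed

lemma EK_add_square:
  fixes f :: "real ^ 'd \<Rightarrow> real"
  assumes "history n xs"
  shows "EK xs (\<lambda>x. (a + f x)\<^sup>2) = a\<^sup>2 + 2 * a * EK xs f + EK xs (\<lambda>x. (f x)\<^sup>2)"
proof -
  have "EK xs (\<lambda>x. (a + f x)\<^sup>2) = EK xs (\<lambda>x. a\<^sup>2 + 2 * a * f x + (f x)\<^sup>2)"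
    by (simp add: power2_sum add_ac)
  also have "\<dots> = a\<^sup>2 + 2 * a * EK xs f + EK xs (\<lambda>x. (f x)\<^sup>2)"
    by (simp add: integrable_kernel[OF assms])
  finally show ?thesis .
qed

lemma E_one:
  fixes F :: "(real ^ 'd) list \<Rightarrow> real"
  assumes "\<And>v. v \<in> erw_dirs \<Longrightarrow> F [v] \<le> C"
  shows "E 1 F \<le> C"
proof -
  have "E 1 F \<le> E 1 (\<lambda>_. C)"
    by (rule E_mono) (use assms in \<open>auto simp: history_def length_Suc_conv\<close>)
  then show ?thesis by simp
qed

text \<open>The drift yields E W_{n+1}^2 <= (1 + 1/n) E W_n^2 + B^2. After division by n + 1 the
  sequence E W_n^2 / n grows by at most B^2 / (n + 1); this is the source of the logarithm.\<close>

lemma E_step_sum_square_le: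
  fixes g :: "real ^ 'd \<Rightarrow> real"
  assumes mean: "(\<Sum>v\<in>erw_dirs. g v) = 0" and B: "\<And>v. v \<in> erw_dirs \<Longrightarrow> \<bar>g v\<bar> \<le> B" and "n > 0"
  shows "E n (\<lambda>xs. (step_sum g xs)\<^sup>2) \<le> B\<^sup>2 * real n * harm n"
  using \<open>n > 0\<close>
proof (induction n rule: nat_induct_non_zero)
  case 1
  then show ?case
    using E_one[of "\<lambda>xs. (step_sum g xs)\<^sup>2" "B\<^sup>2"] power2_le_if_abs_le[OF B]
    by (simp add: harm_def)
next
  case (Suc n)
  have "E (Suc n) (\<lambda>xs. (step_sum g xs)\<^sup>2) = E n (\<lambda>xs. EK xs (\<lambda>x. (step_sum g xs + g x)\<^sup>2))"
    using Suc by (simp add: expectation_erw_steps_Suc)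
  also have "\<dots> \<le> E n (\<lambda>xs. (1 + 1 / real n) * (step_sum g xs)\<^sup>2 + B\<^sup>2)"
  proof (rule E_mono[OF \<open>n > 0\<close>])
    fix xs assume h: "history n xs"
    have "EK xs (\<lambda>x. (g x)\<^sup>2) \<le> B\<^sup>2"
      by (intro EK_le[OF h] power2_le_if_abs_le[OF B])
    then show "EK xs (\<lambda>x. (step_sum g xs + g x)\<^sup>2) \<le> (1 + 1 / real n) * (step_sum g xs)\<^sup>2 + B\<^sup>2"
      unfolding EK_add_square[OF h] EK_mean_zero[OF h mean]
      using \<open>n > 0\<close> by (simp add: field_simps power2_eq_square[of "step_sum g xs"])
  qed
  also have "\<dots> = (1 + 1 / real n) * E n (\<lambda>xs. (step_sum g xs)\<^sup>2) + B\<^sup>2"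
    by (simp add: integrable_erw_steps)
  also have "\<dots> \<le> (1 + 1 / real n) * (B\<^sup>2 * real n * harm n) + B\<^sup>2"
    using Suc.IH by (intro add_right_mono mult_left_mono) auto
  also have "\<dots> = B\<^sup>2 * real (Suc n) * harm (Suc n)"
    using Suc by (simp add: harm_Suc field_simps)
  finally show ?case .
qed

text \<open>The coefficient \<open>(2n + 1) / 3\<close> makes \<open>prefix_sums g - (2n + 1) / 3 * step_sum g\<close> an exact
  martingale, with increments \<open>step_sum g / 3 - (2n / 3) * g X\<close>.\<close>

lemma E_bary_remainder_square_le:
  fixes g :: "real ^ 'd \<Rightarrow> real"
  assumes mean: "(\<Sum>v\<in>erw_dirs. g v) = 0" and B: "\<And>v. v \<in> erw_dirs \<Longrightarrow> \<bar>g v\<bar> \<le> B" and "n > 0"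
  shows "E n (\<lambda>xs. (prefix_sums g xs - (2 * real n + 1) / 3 * step_sum g xs)\<^sup>2) \<le> B\<^sup>2 * real n ^ 3"
  using \<open>n > 0\<close>
proof (induction n rule: nat_induct_non_zero)
  case 1
  \<comment> \<open>At n = 1 the coefficient is 1 and T_1 = W_1, so the remainder vanishes.\<close>
  then show ?case
    using E_one[of "\<lambda>xs. (prefix_sums g xs - (2 * real 1 + 1) / 3 * step_sum g xs)\<^sup>2" "B\<^sup>2"]
    by (simp add: prefix_sums_def)
next
  case (Suc n)
  let ?D = "\<lambda>xs. prefix_sums g xs - (2 * real n + 1) / 3 * step_sum g xs"
  have snoc: "prefix_sums g (xs @ [x]) - (2 * real (Suc n) + 1) / 3 * step_sum g (xs @ [x])
      = ?D xs + (step_sum g xs / 3 - 2 * real n / 3 * g x)" for xs x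
    by (simp add: prefix_sums_snoc field_simps)
  have "E (Suc n) (\<lambda>xs. (prefix_sums g xs - (2 * real (Suc n) + 1) / 3 * step_sum g xs)\<^sup>2)
      = E n (\<lambda>xs. EK xs (\<lambda>x. (?D xs + (step_sum g xs / 3 - 2 * real n / 3 * g x))\<^sup>2))"
    unfolding expectation_erw_steps_Suc[OF \<open>n > 0\<close>] snoc ..
  also have "\<dots> \<le> E n (\<lambda>xs. (?D xs)\<^sup>2 + (real n * B)\<^sup>2)"
  proof (rule E_mono[OF \<open>n > 0\<close>])
    fix xs assume h: "history n xs"
    \<comment> \<open>Martingale property: 2n/3 times the drift W / (2n) is W / 3.\<close>
    have "EK xs (\<lambda>x. step_sum g xs / 3 - 2 * real n / 3 * g x) = 0"
      using Suc by (simp add: integrable_kernel[OF h] EK_mean_zero[OF h mean])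
    moreover have "EK xs (\<lambda>x. (step_sum g xs / 3 - 2 * real n / 3 * g x)\<^sup>2) \<le> (real n * B)\<^sup>2"
    proof (rule EK_le[OF h])
      fix v :: "real ^ 'd" assume v: "v \<in> erw_dirs"
      have "\<bar>step_sum g xs\<bar> \<le> real n * B"
        using abs_step_sum_le[of xs erw_dirs g B] h B by (auto simp: history_def)
      moreover have "\<bar>real n * g v\<bar> \<le> real n * B"
        using B[OF v] by (simp add: abs_mult mult_left_mono)
      \<comment> \<open>One third of nB from the past and two thirds of nB from the new
        step.\<close>
      ultimately have "\<bar>step_sum g xs / 3 - 2 * real n / 3 * g v\<bar> \<le> real n * B"
        by (simp add: abs_le_iff)
      then show "(step_sum g xs / 3 - 2 * real n / 3 * g v)\<^sup>2 \<le> (real n * B)\<^sup>2"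
        by (rule power2_le_if_abs_le)
    qed
    ultimately show "EK xs (\<lambda>x. (?D xs + (step_sum g xs / 3 - 2 * real n / 3 * g x))\<^sup>2) \<le> (?D xs)\<^sup>2 + (real n * B)\<^sup>2"
      by (simp add: EK_add_square[OF h])
  qed
  also have "\<dots> = E n (\<lambda>xs. (?D xs)\<^sup>2) + (real n * B)\<^sup>2"
    by (simp add: integrable_erw_steps)
  also have "\<dots> \<le> B\<^sup>2 * real n ^ 3 + (real n * B)\<^sup>2"
    using Suc.IH by simp
  also have "\<dots> = B\<^sup>2 * (real n ^ 3 + real n ^ 2)"
    by (simp add: algebra_simps power_mult_distrib)
  also have "\<dots> \<le> B\<^sup>2 * real (Suc n) ^ 3"
    by (intro mult_left_mono) (auto simp: power3_eq_cube power2_eq_square algebra_simps)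
  finally show ?case .
qed

end

section \<open>Characteristic functions of the walk and its centre of mass\<close>

text \<open>The drift multiplies W_k by 1 + 1/(2k) on average, while the scaling changes from 1 /
  sqrt k to 1 / sqrt (k + 1). The two effects cancel up to order k powr (-5/2), because the ratio r
  satisfies r^2 = 1 + 1 / (4k (k + 1)).\<close>

lemma sqrt_ratio_approx:
  fixes k :: real
  assumes "k \<ge> 1"
  shows "\<bar>(1 + 1 / (2 * k)) / sqrt (k + 1) - 1 / sqrt k\<bar> \<le> 1 / (8 * k\<^sup>2 * sqrt k)"
proof -
  define r where "r = 1 / sqrt (k + 1) * sqrt k * (1 + 1 / (2 * k))"
  have r2: "r\<^sup>2 = 1 + 1 / (4 * k * (k + 1))"
  proof -
    have k: "k \<noteq> 0" "k + 1 \<noteq> 0" "k \<ge> 0" "k + 1 \<ge> 0" using assms by auto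
    have "1 + 1 / (2 * k) = (2 * k + 1) / (2 * k)"
      using k by (simp add: field_simps)
    then have "r\<^sup>2 = k / (k + 1) * ((2 * k + 1) / (2 * k))\<^sup>2"
      using k by (simp add: r_def power_mult_distrib power_divide)
    also have "\<dots> = 1 + 1 / (4 * k * (k + 1))"
      using k(1,2) by (simp add: divide_simps power2_eq_square) (simp add: algebra_simps)
    finally show ?thesis .
  qed
  have r0: "r \<ge> 0" using assms by (simp add: r_def)
  have r1: "r \<ge> 1"
    using assms r0 by (intro power2_le_imp_le[of 1 r]) (auto simp: r2)
  have "r - 1 \<le> 1 / (8 * k\<^sup>2)"
  proof -
    \<comment> \<open>Since r >= 1, r - 1 is at most half of r^2 - 1.\<close>
    have "2 * (r - 1) \<le> (r + 1) * (r - 1)"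
      using r1 by (intro mult_right_mono) auto
    also have "\<dots> = 1 / (4 * k * (k + 1))"
      using r2 by (simp add: power2_eq_square algebra_simps)
    also have "\<dots> \<le> 1 / (4 * k\<^sup>2)"
      using assms by (intro divide_left_mono) (auto simp: power2_eq_square intro: mult_left_mono)
    finally show ?thesis by (simp add: field_simps)
  qed
  moreover have "(1 + 1 / (2 * k)) / sqrt (k + 1) - 1 / sqrt k = (r - 1) / sqrt k"
    using assms by (simp add: r_def field_simps)
  ultimately show ?thesis
    using r1 assms divide_right_mono[of "r - 1" "1 / (8 * k\<^sup>2)" "sqrt k"] by simp
qed

section \<open>One-step recursion for the characteristic function and its accumulated error\<close>

context critical_erw
begin

text \<open>Three errors add up: the Taylor remainder of the centred step, the deviation of its
  conditional variance from \<sigma>2, and the linearisation of the exponential.\<close>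

lemma char_kernel_approx:
  fixes g :: "real ^ 'd \<Rightarrow> real"
  assumes h: "history n xs" and mean: "(\<Sum>v\<in>erw_dirs. g v) = 0"
    and var: "(\<Sum>v\<in>erw_dirs. (g v)\<^sup>2 - \<sigma>2) = 0"
    and B: "\<And>v. v \<in> erw_dirs \<Longrightarrow> \<bar>g v\<bar> \<le> B" and "\<sigma>2 \<ge> 0" "l \<ge> 0"
  defines "m \<equiv> step_sum g xs / (2 * real n)"
  shows "norm (EK xs (\<lambda>x. cis (l * (g x - m))) - complex_of_real (exp (- (l\<^sup>2 * \<sigma>2 / 2))))
    \<le> (l * (2 * B)) ^ 3 / 6 + l\<^sup>2 / 2 * (\<bar>step_sum (\<lambda>x. (g x)\<^sup>2 - \<sigma>2) xs\<bar> / (2 * real n) + m\<^sup>2) + (l\<^sup>2 * \<sigma>2 / 2)\<^sup>2"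
proof -
  note int = integrable_kernel[OF h]
  have n: "n > 0" "length xs = n" "set xs \<subseteq> erw_dirs" using h by (auto simp: history_def)
  have EKg: "EK xs g = m" unfolding m_def by (rule EK_mean_zero[OF h mean])
  have B0: "B \<ge> 0"
  proof -
    obtain v :: "real ^ 'd" where "v \<in> erw_dirs" using erw_dirs_nonempty by blast
    then show ?thesis using B[of v] by linarith
  qed
  have m: "\<bar>m\<bar> \<le> B"
  proof -
    have "\<bar>step_sum g xs\<bar> \<le> real n * B"
      using abs_step_sum_le[of xs erw_dirs g B] n B by simp
    also have "\<dots> \<le> 2 * real n * B"
      using B0 by (simp add: mult_right_mono)
    finally show ?thesis
      using n(1) by (simp add: m_def field_simps)
  qed
  define q where "q = EK xs (\<lambda>x. (g x - m)\<^sup>2)"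
  have "q = EK xs (\<lambda>x. (- m + g x)\<^sup>2)" by (simp add: q_def)
  also have "\<dots> = EK xs (\<lambda>x. (g x)\<^sup>2) - m\<^sup>2"
    by (simp only: EK_add_square[OF h] EKg) (simp add: power2_eq_square)
  also have "EK xs (\<lambda>x. (g x)\<^sup>2) = EK xs (\<lambda>x. (g x)\<^sup>2 - \<sigma>2) + \<sigma>2"
    by (simp add: int)
  \<comment> \<open>The centred square is itself a function with mean zero over the directions, so
    the drift formula applies to it.\<close>
  also have "EK xs (\<lambda>x. (g x)\<^sup>2 - \<sigma>2) = step_sum (\<lambda>x. (g x)\<^sup>2 - \<sigma>2) xs / (2 * real n)"
    by (rule EK_mean_zero[OF h var])
  finally have q: "q = step_sum (\<lambda>x. (g x)\<^sup>2 - \<sigma>2) xs / (2 * real n) + \<sigma>2 - m\<^sup>2" .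
  let ?e = "exp (- (l\<^sup>2 * \<sigma>2 / 2))"
  have 1: "norm (EK xs (\<lambda>x. cis (l * (g x - m))) - complex_of_real (1 - l\<^sup>2 / 2 * q)) \<le> (l * (2 * B)) ^ 3 / 6"
    unfolding q_def
  proof (rule char_centered_approx)
    show "finite (set_pmf (erw_kernel p xs))"
      using n by (intro finite_subset[OF set_erw_kernel finite_erw_dirs]) auto
    show "EK xs (\<lambda>x. g x - m) = 0" by (simp add: int EKg)
    show "\<bar>g x - m\<bar> \<le> 2 * B" if "x \<in> set_pmf (erw_kernel p xs)" for x
      using B[OF kernel_dirs[OF h that]] m by linarith
  qed fact
  have 2: "\<bar>?e - (1 - l\<^sup>2 * \<sigma>2 / 2)\<bar> \<le> (l\<^sup>2 * \<sigma>2 / 2)\<^sup>2"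
    using \<open>\<sigma>2 \<ge> 0\<close> by (intro exp_minus_approx) auto
  have 3: "\<bar>(1 - l\<^sup>2 / 2 * q) - (1 - l\<^sup>2 * \<sigma>2 / 2)\<bar>
      \<le> l\<^sup>2 / 2 * (\<bar>step_sum (\<lambda>x. (g x)\<^sup>2 - \<sigma>2) xs\<bar> / (2 * real n) + m\<^sup>2)"
  proof -
    have "(1 - l\<^sup>2 / 2 * q) - (1 - l\<^sup>2 * \<sigma>2 / 2) = l\<^sup>2 / 2 * (\<sigma>2 - q)"
      by (simp add: field_simps)
    then have "\<bar>(1 - l\<^sup>2 / 2 * q) - (1 - l\<^sup>2 * \<sigma>2 / 2)\<bar> = \<bar>l\<^sup>2 / 2 * (\<sigma>2 - q)\<bar>"
      by (rule arg_cong)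
    also have "\<dots> = l\<^sup>2 / 2 * \<bar>\<sigma>2 - q\<bar>"
      by (simp add: abs_mult)
    also have "\<bar>\<sigma>2 - q\<bar> \<le> \<bar>step_sum (\<lambda>x. (g x)\<^sup>2 - \<sigma>2) xs\<bar> / (2 * real n) + m\<^sup>2"
    proof -
      have "\<bar>\<sigma>2 - q\<bar> = \<bar>m\<^sup>2 - step_sum (\<lambda>x. (g x)\<^sup>2 - \<sigma>2) xs / (2 * real n)\<bar>"
        by (simp add: q)
      also have "\<dots> \<le> \<bar>m\<^sup>2\<bar> + \<bar>step_sum (\<lambda>x. (g x)\<^sup>2 - \<sigma>2) xs / (2 * real n)\<bar>"
        by (rule abs_triangle_ineq4)
      finally show ?thesis by simp
    qed
    finally show ?thesis by (simp add: mult_left_mono)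
  qed
  have "norm (EK xs (\<lambda>x. cis (l * (g x - m))) - complex_of_real ?e)
      \<le> norm (EK xs (\<lambda>x. cis (l * (g x - m))) - complex_of_real (1 - l\<^sup>2 / 2 * q))
        + norm (complex_of_real (1 - l\<^sup>2 / 2 * q) - complex_of_real ?e)"
    using dist_triangle[of "EK xs (\<lambda>x. cis (l * (g x - m)))" "complex_of_real ?e" "complex_of_real (1 - l\<^sup>2 / 2 * q)"]
    unfolding dist_norm .
  also have "norm (complex_of_real (1 - l\<^sup>2 / 2 * q) - complex_of_real ?e) = \<bar>(1 - l\<^sup>2 / 2 * q) - ?e\<bar>"
    by (metis norm_of_real of_real_diff)
  finally show ?thesis using 1 2 3 by linarith
qed

text \<open>The new phase splits into the conditional mean l (W + m) and the centred part l (g - m).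
  The centred part becomes the Gaussian factor; l (W + m) = l (1 + 1/(2n)) W is compared with the
  old phase l' W.\<close>

lemma E_char_step:
  fixes g :: "real ^ 'd \<Rightarrow> real"
  assumes mean: "(\<Sum>v\<in>erw_dirs. g v) = 0"
    and var: "(\<Sum>v\<in>erw_dirs. (g v)\<^sup>2 - \<sigma>2) = 0"
    and B: "\<And>v. v \<in> erw_dirs \<Longrightarrow> \<bar>g v\<bar> \<le> B" and "\<sigma>2 \<ge> 0" "n > 0" "l \<ge> 0"
  shows "norm (E (Suc n) (\<lambda>xs. cis (l * step_sum g xs))
      - complex_of_real (exp (- (l\<^sup>2 * \<sigma>2 / 2))) * E n (\<lambda>xs. cis (l' * step_sum g xs)))
    \<le> (l * (2 * B)) ^ 3 / 6 + l\<^sup>2 / (4 * real n) * E n (\<lambda>xs. \<bar>step_sum (\<lambda>x. (g x)\<^sup>2 - \<sigma>2) xs\<bar>)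
      + l\<^sup>2 / (8 * (real n)\<^sup>2) * E n (\<lambda>xs. (step_sum g xs)\<^sup>2) + (l\<^sup>2 * \<sigma>2 / 2)\<^sup>2
      + \<bar>l * (1 + 1 / (2 * real n)) - l'\<bar> * (real n * B)"
proof -
  let ?e = "exp (- (l\<^sup>2 * \<sigma>2 / 2))"
  let ?V = "step_sum (\<lambda>x. (g x)\<^sup>2 - \<sigma>2)"
  let ?F = "\<lambda>xs. EK xs (\<lambda>x. cis (l * (step_sum g xs + g x)))
      - complex_of_real ?e * cis (l' * step_sum g xs)"
  let ?R = "\<lambda>xs. (l * (2 * B)) ^ 3 / 6 + l\<^sup>2 / (4 * real n) * \<bar>?V xs\<bar>
      + l\<^sup>2 / (8 * (real n)\<^sup>2) * (step_sum g xs)\<^sup>2 + (l\<^sup>2 * \<sigma>2 / 2)\<^sup>2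
      + \<bar>l * (1 + 1 / (2 * real n)) - l'\<bar> * (real n * B)"
  have bound: "norm (?F xs) \<le> ?R xs" if h: "history n xs" for xs
  proof -
    define W where "W = step_sum g xs"
    define m where "m = W / (2 * real n)"
    have n: "length xs = n" "set xs \<subseteq> erw_dirs" using h by (auto simp: history_def)
    have W: "\<bar>W\<bar> \<le> real n * B"
      unfolding W_def using abs_step_sum_le[of xs erw_dirs g B] n B by simp
    have e: "0 \<le> ?e" "?e \<le> 1" using \<open>\<sigma>2 \<ge> 0\<close> by auto
    have eq: "EK xs (\<lambda>x. cis (l * (W + g x))) = cis (l * (W + m)) * EK xs (\<lambda>x. cis (l * (g x - m)))"
      by (subst integral_mult_right_zero[symmetric])
        (intro Bochner_Integration.integral_cong refl, simp add: cis_mult algebra_simps)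
    have "EK xs (\<lambda>x. cis (l * (W + g x))) - complex_of_real ?e * cis (l' * W)
        = cis (l * (W + m)) * (EK xs (\<lambda>x. cis (l * (g x - m))) - complex_of_real ?e)
          + complex_of_real ?e * (cis (l * (W + m)) - cis (l' * W))"
      unfolding eq by (simp add: algebra_simps)
    then have "norm (EK xs (\<lambda>x. cis (l * (W + g x))) - complex_of_real ?e * cis (l' * W))
        \<le> norm (cis (l * (W + m)) * (EK xs (\<lambda>x. cis (l * (g x - m))) - complex_of_real ?e))
          + norm (complex_of_real ?e * (cis (l * (W + m)) - cis (l' * W)))"
      by (metis norm_triangle_ineq)
    also have "\<dots> = norm (EK xs (\<lambda>x. cis (l * (g x - m))) - complex_of_real ?e)
          + ?e * norm (cis (l * (W + m)) - cis (l' * W))"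
      by (simp add: norm_mult)
    also have "norm (EK xs (\<lambda>x. cis (l * (g x - m))) - complex_of_real ?e)
        \<le> (l * (2 * B)) ^ 3 / 6 + l\<^sup>2 / 2 * (\<bar>?V xs\<bar> / (2 * real n) + m\<^sup>2) + (l\<^sup>2 * \<sigma>2 / 2)\<^sup>2"
      unfolding m_def W_def
      by (rule char_kernel_approx[OF h mean var B \<open>\<sigma>2 \<ge> 0\<close> \<open>l \<ge> 0\<close>])
    also have "?e * norm (cis (l * (W + m)) - cis (l' * W)) \<le> 1 * \<bar>l * (W + m) - l' * W\<bar>"
      using e by (intro mult_mono norm_cis_diff) auto
    also have "l * (W + m) - l' * W = (l * (1 + 1 / (2 * real n)) - l') * W"
      by (simp add: m_def algebra_simps)
    also have "1 * \<bar>(l * (1 + 1 / (2 * real n)) - l') * W\<bar> \<le> \<bar>l * (1 + 1 / (2 * real n)) - l'\<bar> * (real n * B)"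
      using W by (simp add: abs_mult mult_left_mono)
    finally show ?thesis
      using \<open>n > 0\<close> unfolding m_def W_def by (simp add: field_simps power2_eq_square)
  qed
  have "E (Suc n) (\<lambda>xs. cis (l * step_sum g xs)) - complex_of_real ?e * E n (\<lambda>xs. cis (l' * step_sum g xs))
      = E n ?F"
    using \<open>n > 0\<close> by (simp add: expectation_erw_steps_Suc integrable_erw_steps)
  then have "norm (E (Suc n) (\<lambda>xs. cis (l * step_sum g xs))
      - complex_of_real ?e * E n (\<lambda>xs. cis (l' * step_sum g xs))) \<le> E n (\<lambda>xs. norm (?F xs))"
    by (simp only: integral_norm_bound)
  also have "\<dots> \<le> E n ?R"
    by (rule E_mono[OF \<open>n > 0\<close> bound])
  also have "\<dots> = (l * (2 * B)) ^ 3 / 6 + l\<^sup>2 / (4 * real n) * E n (\<lambda>xs. \<bar>?V xs\<bar>)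
      + l\<^sup>2 / (8 * (real n)\<^sup>2) * E n (\<lambda>xs. (step_sum g xs)\<^sup>2) + (l\<^sup>2 * \<sigma>2 / 2)\<^sup>2
      + \<bar>l * (1 + 1 / (2 * real n)) - l'\<bar> * (real n * B)"
    by (simp add: integrable_erw_steps)
  finally show ?thesis .
qed

text \<open>The dominant error is the variance deviation, of order 1/n^2 times E |V| = O(n powr
  (3/4)); the others are of order n powr (-3/2) or smaller. A factor \<theta> is kept in each, using
  \<theta> <= 1, so that the total vanishes with \<theta>.\<close>

lemma E_char_step_error:
  fixes g :: "real ^ 'd \<Rightarrow> real"
  assumes mean: "(\<Sum>v\<in>erw_dirs. g v) = 0"
    and var: "(\<Sum>v\<in>erw_dirs. (g v)\<^sup>2 - \<sigma>2) = 0"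
    and B: "\<And>v. v \<in> erw_dirs \<Longrightarrow> \<bar>g v\<bar> \<le> B" and "\<sigma>2 \<ge> 0" "n > 0" and \<theta>: "0 \<le> \<theta>" "\<theta> \<le> 1"
  shows "norm (E (Suc n) (\<lambda>xs. cis (\<theta> / sqrt (real (Suc n)) * step_sum g xs))
      - complex_of_real (exp (- (\<theta>\<^sup>2 * \<sigma>2 / 2 * (1 / real (Suc n))))) * E n (\<lambda>xs. cis (\<theta> / sqrt (real n) * step_sum g xs)))
    \<le> \<theta> * ((4 / 3 * B ^ 3 + (1 / 2 + B ^ 4) / 4 + B\<^sup>2 / 4 + \<sigma>2\<^sup>2 / 4 + B / 8) * real n powr (- 5 / 4))"
proof -
  define x where "x = real n"
  define l where "l = \<theta> / sqrt (x + 1)"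
  define r where "r = x powr (- 5 / 4)"
  have x: "x \<ge> 1" using \<open>n > 0\<close> by (simp add: x_def)
  have l0: "l \<ge> 0" using \<theta> x by (simp add: l_def)
  obtain v0 :: "real ^ 'd" where v0: "v0 \<in> erw_dirs" using erw_dirs_nonempty by blast
  have B0: "B \<ge> 0" using B[OF v0] by linarith
  have g2: "(g v)\<^sup>2 \<le> B\<^sup>2" if "v \<in> erw_dirs" for v
    using B[OF that] by (rule power2_le_if_abs_le)
  \<comment> \<open>\<sigma>2 is the average of g^2 over the directions, so the centred square is
    bounded by B^2.\<close>
  have "\<sigma>2 \<le> B\<^sup>2"
  proof -
    have "real (card (erw_dirs :: (real ^ 'd) set)) * \<sigma>2 = (\<Sum>v\<in>erw_dirs. (g v)\<^sup>2)"
      using var by (simp add: sum_subtractf)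
    also have "\<dots> \<le> real (card (erw_dirs :: (real ^ 'd) set)) * B\<^sup>2"
      using g2 by (rule sum_bounded_above)
    finally show ?thesis
      by (simp add: card_erw_dirs)
  qed
  then have V: "\<bar>(g v)\<^sup>2 - \<sigma>2\<bar> \<le> B\<^sup>2" if "v \<in> erw_dirs" for v
    using g2[OF that] \<open>\<sigma>2 \<ge> 0\<close> zero_le_power2[of "g v"] by linarith
  have sqrt_x: "sqrt x = x powr (1 / 2)" using x by (simp add: powr_half_sqrt)
  have harm: "harm n \<le> 2 * x powr (1 / 2)"
    using harm_le_sqrt[of n] by (simp add: x_def powr_half_sqrt)
  have r32: "x powr (- 3 / 2) \<le> r" and r2: "x powr (- 2) \<le> r"
    unfolding r_def using x by (auto intro: powr_mono)
  have xpow: "1 / (x * sqrt x) = x powr (- 3 / 2)" "1 / x\<^sup>2 = x powr (- 2)"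
    "x powr (3 / 4) / x\<^sup>2 = r" "x * x powr (1 / 2) / x ^ 3 = x powr (- 3 / 2)"
    "x * x powr (1 / 2) / x powr (3 / 4) = x powr (3 / 4)"
    "x / (x\<^sup>2 * sqrt x) = x powr (- 3 / 2)"
  proof -
    have p: "x = x powr 1" "x\<^sup>2 = x powr 2" "x ^ 3 = x powr 3"
      using x by (simp_all add: powr_numeral)
    have d: "1 / x powr a = x powr (- a)" for a
      by (simp add: powr_minus_divide)
    show "1 / x\<^sup>2 = x powr (- 2)" using p d by metis
    have "x * sqrt x = x powr (3 / 2)"
      using p(1) powr_add[of x 1 "1 / 2"] by (simp add: sqrt_x)
    then show "1 / (x * sqrt x) = x powr (- 3 / 2)" using d[of "3 / 2"] by simp
    show "x powr (3 / 4) / x\<^sup>2 = r"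
      using powr_diff[of x "3 / 4" 2] p(2) by (simp add: r_def)
    have a: "x * x powr (1 / 2) = x powr (3 / 2)"
      using p(1) powr_add[of x 1 "1 / 2"] by simp
    show "x * x powr (1 / 2) / x ^ 3 = x powr (- 3 / 2)"
      using powr_diff[of x "3 / 2" 3] p(3) a by simp
    show "x * x powr (1 / 2) / x powr (3 / 4) = x powr (3 / 4)"
      using powr_diff[of x "3 / 2" "3 / 4"] a by simp
    have "x\<^sup>2 * sqrt x = x powr (5 / 2)"
      using p(2) powr_add[of x 2 "1 / 2"] by (simp add: sqrt_x)
    then show "x / (x\<^sup>2 * sqrt x) = x powr (- 3 / 2)"
      using powr_diff[of x 1 "5 / 2"] p(1) by simp
  qed
  have l2: "l\<^sup>2 \<le> \<theta> / x"
  proof -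
    have "l\<^sup>2 = \<theta>\<^sup>2 / (x + 1)" using x by (simp add: l_def power_divide)
    also have "\<dots> \<le> \<theta> / x"
      using \<theta> x by (intro frac_le) (auto simp: power2_eq_square mult_left_le)
    finally show ?thesis .
  qed
  have l3: "l ^ 3 \<le> \<theta> * x powr (- 3 / 2)"
  proof -
    have "l \<le> 1 / sqrt x"
      unfolding l_def using \<theta> x by (intro frac_le) auto
    then have "l\<^sup>2 * l \<le> \<theta> / x * (1 / sqrt x)"
      using l2 l0 \<theta> x by (intro mult_mono) auto
    also have "\<dots> = \<theta> * (1 / (x * sqrt x))" by simp
    finally show ?thesis by (simp add: xpow power3_eq_cube power2_eq_square)
  qed
  have l4: "(l\<^sup>2)\<^sup>2 \<le> \<theta> * x powr (- 2)"
  proof -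
    have "(l\<^sup>2)\<^sup>2 \<le> (\<theta> / x)\<^sup>2" using l2 by (intro power_mono) auto
    also have "\<dots> \<le> \<theta> * (1 / x\<^sup>2)"
      using \<theta> x by (simp add: power_divide divide_right_mono power2_eq_square[of \<theta>] mult_left_le)
    finally show ?thesis by (simp only: xpow)
  qed
  have t1: "(l * (2 * B)) ^ 3 / 6 \<le> \<theta> * (4 / 3 * B ^ 3 * r)"
  proof -
    have "(l * (2 * B)) ^ 3 / 6 = 4 / 3 * B ^ 3 * l ^ 3"
      by (simp add: power_mult_distrib)
    also have "\<dots> \<le> 4 / 3 * B ^ 3 * (\<theta> * r)"
      using l3 r32 \<theta> B0 by (intro mult_left_mono order_trans[OF l3]) auto
    finally show ?thesis by (simp add: mult_ac)
  qed
  have t2: "l\<^sup>2 / (4 * x) * E n (\<lambda>xs. \<bar>step_sum (\<lambda>x. (g x)\<^sup>2 - \<sigma>2) xs\<bar>) \<le> \<theta> * ((1 / 2 + B ^ 4) / 4 * r)"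
  proof -
    let ?V = "step_sum (\<lambda>x. (g x)\<^sup>2 - \<sigma>2)"
    \<comment> \<open>The square root of the order x powr (3/2) of E V^2 balances the two AM-GM
      terms.\<close>
    define c where "c = x powr (3 / 4)"
    have c: "c > 0" using x by (simp add: c_def)
    have "E n (\<lambda>xs. \<bar>?V xs\<bar>) \<le> E n (\<lambda>xs. (c + (?V xs)\<^sup>2 / c) / 2)"
      by (rule E_mono[OF \<open>n > 0\<close> abs_le_half_add[OF c]])
    also have "\<dots> = (c + E n (\<lambda>xs. (?V xs)\<^sup>2) / c) / 2"
      by (simp add: integrable_erw_steps)
    also have "E n (\<lambda>xs. (?V xs)\<^sup>2) \<le> (B\<^sup>2)\<^sup>2 * x * harm n"
      unfolding x_def by (rule E_step_sum_square_le[OF var V \<open>n > 0\<close>])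
    also have "\<dots> \<le> (B\<^sup>2)\<^sup>2 * x * (2 * x powr (1 / 2))"
      using harm x by (intro mult_left_mono) auto
    also have "(c + (B\<^sup>2)\<^sup>2 * x * (2 * x powr (1 / 2)) / c) / 2
        = (c + 2 * B ^ 4 * (x * x powr (1 / 2) / c)) / 2"
      by (simp add: mult_ac flip: power_mult)
    also have "\<dots> = (1 / 2 + B ^ 4) * c"
      unfolding c_def xpow by (simp add: algebra_simps)
    finally have EV: "E n (\<lambda>xs. \<bar>?V xs\<bar>) \<le> (1 / 2 + B ^ 4) * c"
      using c by (simp add: divide_right_mono)
    have "l\<^sup>2 / (4 * x) * E n (\<lambda>xs. \<bar>?V xs\<bar>) \<le> (\<theta> / x) / (4 * x) * ((1 / 2 + B ^ 4) * c)"
      using l2 EV x \<theta> by (intro mult_mono divide_right_mono) (auto intro!: integral_nonneg_AE)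
    also have "\<dots> = \<theta> * ((1 / 2 + B ^ 4) / 4 * (c / x\<^sup>2))"
      by (simp add: power2_eq_square)
    also have "c / x\<^sup>2 = r" unfolding c_def by (rule xpow)
    finally show ?thesis .
  qed
  have t3: "l\<^sup>2 / (8 * x\<^sup>2) * E n (\<lambda>xs. (step_sum g xs)\<^sup>2) \<le> \<theta> * (B\<^sup>2 / 4 * r)"
  proof -
    have "E n (\<lambda>xs. (step_sum g xs)\<^sup>2) \<le> B\<^sup>2 * x * harm n"
      unfolding x_def by (rule E_step_sum_square_le[OF mean B \<open>n > 0\<close>])
    also have "\<dots> \<le> B\<^sup>2 * x * (2 * x powr (1 / 2))"
      using harm x by (intro mult_left_mono) auto
    finally have "l\<^sup>2 / (8 * x\<^sup>2) * E n (\<lambda>xs. (step_sum g xs)\<^sup>2)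
        \<le> (\<theta> / x) / (8 * x\<^sup>2) * (B\<^sup>2 * x * (2 * x powr (1 / 2)))"
      using l2 x \<theta> by (intro mult_mono divide_right_mono) auto
    also have "\<dots> = \<theta> * (B\<^sup>2 / 4 * (x * x powr (1 / 2) / x ^ 3))"
      by (simp add: power2_eq_square power3_eq_cube)
    also have "\<dots> \<le> \<theta> * (B\<^sup>2 / 4 * r)"
      unfolding xpow using r32 \<theta> by (intro mult_left_mono) auto
    finally show ?thesis .
  qed
  have t4: "(l\<^sup>2 * \<sigma>2 / 2)\<^sup>2 \<le> \<theta> * (\<sigma>2\<^sup>2 / 4 * r)"
  proof -
    have "(l\<^sup>2 * \<sigma>2 / 2)\<^sup>2 = \<sigma>2\<^sup>2 / 4 * (l\<^sup>2)\<^sup>2"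
      by (simp add: power_mult_distrib power_divide)
    also have "\<dots> \<le> \<sigma>2\<^sup>2 / 4 * (\<theta> * r)"
      using \<theta> r2 by (intro mult_left_mono order_trans[OF l4]) auto
    finally show ?thesis by (simp add: mult_ac)
  qed
  have t5: "\<bar>l * (1 + 1 / (2 * x)) - \<theta> / sqrt x\<bar> * (x * B) \<le> \<theta> * (B / 8 * r)"
  proof -
    have "l * (1 + 1 / (2 * x)) - \<theta> / sqrt x = \<theta> * ((1 + 1 / (2 * x)) / sqrt (x + 1) - 1 / sqrt x)"
      by (simp add: l_def algebra_simps add_divide_distrib)
    then have "\<bar>l * (1 + 1 / (2 * x)) - \<theta> / sqrt x\<bar> * (x * B)
        = \<theta> * \<bar>(1 + 1 / (2 * x)) / sqrt (x + 1) - 1 / sqrt x\<bar> * (x * B)"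
      using \<theta> by (simp only: abs_mult abs_of_nonneg)
    also have "\<dots> \<le> \<theta> * (1 / (8 * x\<^sup>2 * sqrt x)) * (x * B)"
      using sqrt_ratio_approx[OF x] \<theta> x B0 by (intro mult_left_mono mult_right_mono) auto
    also have "\<dots> = \<theta> * (B / 8 * (x / (x\<^sup>2 * sqrt x)))"
      by (simp add: mult_ac)
    also have "\<dots> \<le> \<theta> * (B / 8 * r)"
      unfolding xpow using r32 \<theta> B0 by (intro mult_left_mono) auto
    finally show ?thesis .
  qed
  have l2_eq: "l\<^sup>2 * \<sigma>2 / 2 = \<theta>\<^sup>2 * \<sigma>2 / 2 * (1 / real (Suc n))"
    using x by (simp add: l_def power_divide x_def add.commute)
  have l_eq: "l = \<theta> / sqrt (real (Suc n))"
    by (simp add: l_def x_def add.commute)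
  have "norm (E (Suc n) (\<lambda>xs. cis (l * step_sum g xs))
      - complex_of_real (exp (- (l\<^sup>2 * \<sigma>2 / 2))) * E n (\<lambda>xs. cis (\<theta> / sqrt x * step_sum g xs)))
    \<le> (l * (2 * B)) ^ 3 / 6 + l\<^sup>2 / (4 * x) * E n (\<lambda>xs. \<bar>step_sum (\<lambda>x. (g x)\<^sup>2 - \<sigma>2) xs\<bar>)
      + l\<^sup>2 / (8 * x\<^sup>2) * E n (\<lambda>xs. (step_sum g xs)\<^sup>2) + (l\<^sup>2 * \<sigma>2 / 2)\<^sup>2
      + \<bar>l * (1 + 1 / (2 * x)) - \<theta> / sqrt x\<bar> * (x * B)"
    unfolding x_def by (rule E_char_step[OF mean var B \<open>\<sigma>2 \<ge> 0\<close> \<open>n > 0\<close> l0])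
  also have "\<dots> \<le> \<theta> * (4 / 3 * B ^ 3 * r) + \<theta> * ((1 / 2 + B ^ 4) / 4 * r) + \<theta> * (B\<^sup>2 / 4 * r)
      + \<theta> * (\<sigma>2\<^sup>2 / 4 * r) + \<theta> * (B / 8 * r)"
    by (intro add_mono t1 t2 t3 t4 t5)
  also have "\<dots> = \<theta> * ((4 / 3 * B ^ 3 + (1 / 2 + B ^ 4) / 4 + B\<^sup>2 / 4 + \<sigma>2\<^sup>2 / 4 + B / 8) * r)"
    by (simp only: distrib_left distrib_right)
  finally show ?thesis
    unfolding l2_eq unfolding l_eq x_def r_def .
qed

text \<open>The Gaussian factors multiply to an exponential of the harmonic number. They are at most
  1, so the one-step errors merely add, and the series converges. C depends neither on n nor on
  \<theta>, so \<theta> may later vary with n.\<close>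

lemma E_char_bound:
  fixes g :: "real ^ 'd \<Rightarrow> real"
  assumes mean: "(\<Sum>v\<in>erw_dirs. g v) = 0"
    and var: "(\<Sum>v\<in>erw_dirs. (g v)\<^sup>2 - \<sigma>2) = 0"
    and B: "\<And>v. v \<in> erw_dirs \<Longrightarrow> \<bar>g v\<bar> \<le> B" and "\<sigma>2 \<ge> 0"
  shows "\<exists>C. \<forall>n>0. \<forall>\<theta>. 0 \<le> \<theta> \<longrightarrow> \<theta> \<le> 1 \<longrightarrow>
    norm (E n (\<lambda>xs. cis (\<theta> / sqrt (real n) * step_sum g xs)) - complex_of_real (exp (- (\<theta>\<^sup>2 * \<sigma>2 / 2 * harm n)))) \<le> \<theta> * C"
proof -
  define K where "K = 4 / 3 * B ^ 3 + (1 / 2 + B ^ 4) / 4 + B\<^sup>2 / 4 + \<sigma>2\<^sup>2 / 4 + B / 8"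
  \<comment> \<open>The term at 0 is 0 because \<open>0 powr a = 0\<close>, so the sum over k < n is
    empty in effect at n = 1.\<close>
  let ?a = "\<lambda>n. real n powr (- 5 / 4)"
  obtain v0 :: "real ^ 'd" where v0: "v0 \<in> erw_dirs" using erw_dirs_nonempty by blast
  have B0: "B \<ge> 0" using B[OF v0] by linarith
  have K0: "K \<ge> 0" using B0 by (simp add: K_def)
  have summable: "summable ?a" by (subst summable_real_powr_iff) simp
  have partial: "norm (E n (\<lambda>xs. cis (\<theta> / sqrt (real n) * step_sum g xs)) - complex_of_real (exp (- (\<theta>\<^sup>2 * \<sigma>2 / 2 * harm n))))
      \<le> \<theta> * (B + \<sigma>2 / 2 + K * (\<Sum>k<n. ?a k))" if "n > 0" and \<theta>: "0 \<le> \<theta>" "\<theta> \<le> 1" for n \<theta>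
    using \<open>n > 0\<close>
  proof (induction n rule: nat_induct_non_zero)
    case 1
    \<comment> \<open>At n = 1 both the characteristic function and its target lie within a multiple
      of \<theta> of 1.\<close>
    have e: "\<bar>1 - exp (- (\<theta>\<^sup>2 * \<sigma>2 / 2))\<bar> \<le> \<theta> * (\<sigma>2 / 2)"
    proof -
      have "1 - exp (- (\<theta>\<^sup>2 * \<sigma>2 / 2)) \<le> \<theta>\<^sup>2 * \<sigma>2 / 2"
        using exp_ge_add_one_self[of "- (\<theta>\<^sup>2 * \<sigma>2 / 2)"] by linarith
      also have "\<dots> \<le> \<theta> * \<sigma>2 / 2"
        using \<theta> \<open>\<sigma>2 \<ge> 0\<close> by (simp add: power2_eq_square mult_left_le mult_right_mono)
      finally show ?thesis using \<open>\<sigma>2 \<ge> 0\<close> by simp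
    qed
    have "norm (E 1 (\<lambda>xs. cis (\<theta> * step_sum g xs)) - 1) = norm (E 1 (\<lambda>xs. cis (\<theta> * step_sum g xs) - 1))"
      by (subst Bochner_Integration.integral_diff[OF integrable_erw_steps integrable_erw_steps]) simp
    also have "\<dots> \<le> E 1 (\<lambda>xs. norm (cis (\<theta> * step_sum g xs) - 1))"
      by (rule integral_norm_bound)
    also have "\<dots> \<le> \<theta> * B"
    proof (rule E_one)
      fix v :: "real ^ 'd" assume v: "v \<in> erw_dirs"
      have "norm (cis (\<theta> * g v) - cis 0) \<le> \<bar>\<theta> * g v\<bar>"
        using norm_cis_diff[of "\<theta> * g v" 0] by simp
      also have "\<dots> \<le> \<theta> * B"
        using B[OF v] \<theta> by (simp add: abs_mult mult_left_mono)
      finally show "norm (cis (\<theta> * step_sum g [v]) - 1) \<le> \<theta> * B" by simp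
    qed
    finally have 1: "norm (E 1 (\<lambda>xs. cis (\<theta> * step_sum g xs)) - 1) \<le> \<theta> * B" .
    have "norm (E 1 (\<lambda>xs. cis (\<theta> * step_sum g xs)) - complex_of_real (exp (- (\<theta>\<^sup>2 * \<sigma>2 / 2))))
        \<le> norm (E 1 (\<lambda>xs. cis (\<theta> * step_sum g xs)) - 1) + norm (1 - complex_of_real (exp (- (\<theta>\<^sup>2 * \<sigma>2 / 2))))"
      using norm_triangle_ineq[of "E 1 (\<lambda>xs. cis (\<theta> * step_sum g xs)) - 1" "1 - complex_of_real (exp (- (\<theta>\<^sup>2 * \<sigma>2 / 2)))"]
      by (simp only: diff_add_cancel add_diff_eq)
    also have "norm (1 - complex_of_real (exp (- (\<theta>\<^sup>2 * \<sigma>2 / 2)))) = \<bar>1 - exp (- (\<theta>\<^sup>2 * \<sigma>2 / 2))\<bar>"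
      by (metis norm_of_real of_real_1 of_real_diff)
    finally have "norm (E 1 (\<lambda>xs. cis (\<theta> * step_sum g xs)) - complex_of_real (exp (- (\<theta>\<^sup>2 * \<sigma>2 / 2)))) \<le> \<theta> * (B + \<sigma>2 / 2)"
      using 1 e by (simp only: distrib_left)
    then show ?case by (simp add: harm_def)
  next
    case (Suc n)
    define e where "e = exp (- (\<theta>\<^sup>2 * \<sigma>2 / 2 * (1 / real (Suc n))))"
    define u where "u n = E n (\<lambda>xs. cis (\<theta> / sqrt (real n) * step_sum g xs))" for n
    define w where "w n = complex_of_real (exp (- (\<theta>\<^sup>2 * \<sigma>2 / 2 * harm n)))" for n
    have w: "w (Suc n) = complex_of_real e * w n"
      unfolding w_def e_def harm_Suc
      by (simp add: inverse_eq_divide distrib_left exp_add[symmetric] add.commute flip: of_real_mult)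
    have "u (Suc n) - w (Suc n) = (u (Suc n) - complex_of_real e * u n) + complex_of_real e * (u n - w n)"
      by (simp add: w algebra_simps)
    then have "norm (u (Suc n) - w (Suc n)) \<le> norm (u (Suc n) - complex_of_real e * u n) + norm (complex_of_real e * (u n - w n))"
      by (metis norm_triangle_ineq)
    also have "norm (u (Suc n) - complex_of_real e * u n) \<le> \<theta> * (K * ?a n)"
      unfolding u_def e_def K_def by (rule E_char_step_error[OF mean var B \<open>\<sigma>2 \<ge> 0\<close> \<open>n > 0\<close> \<theta>])
    also have "norm (complex_of_real e * (u n - w n)) \<le> 1 * norm (u n - w n)"
      unfolding norm_mult using \<open>\<sigma>2 \<ge> 0\<close> by (intro mult_right_mono) (auto simp: e_def)
    also have "norm (u n - w n) \<le> \<theta> * (B + \<sigma>2 / 2 + K * (\<Sum>k<n. ?a k))"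
      unfolding u_def w_def by (rule Suc.IH)
    finally show ?case
      unfolding u_def w_def by (simp add: algebra_simps)
  qed
  show ?thesis
  proof (intro exI allI impI)
    fix n :: nat and \<theta> :: real assume n: "n > 0" and \<theta>: "0 \<le> \<theta>" "\<theta> \<le> 1"
    have "(\<Sum>k<n. ?a k) \<le> suminf ?a"
      using summable by (intro sum_le_suminf) auto
    then have "\<theta> * (B + \<sigma>2 / 2 + K * (\<Sum>k<n. ?a k)) \<le> \<theta> * (B + \<sigma>2 / 2 + K * suminf ?a)"
      using \<theta> K0 by (intro mult_left_mono add_left_mono) auto
    with partial[OF n \<theta>] show "norm (E n (\<lambda>xs. cis (\<theta> / sqrt (real n) * step_sum g xs)) - complex_of_real (exp (- (\<theta>\<^sup>2 * \<sigma>2 / 2 * harm n))))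
        \<le> \<theta> * (B + \<sigma>2 / 2 + K * suminf ?a)"
      by linarith
  qed
qed

end

section \<open>From harmonic numbers to logarithms\<close>

lemma harm_over_ln_tendsto: "(\<lambda>n. harm n / ln (real n)) \<longlonglongrightarrow> 1"
proof -
  have ln: "filterlim (\<lambda>n. ln (real n)) at_top sequentially"
    by (rule filterlim_compose[OF ln_at_top filterlim_real_sequentially])
  \<comment> \<open>The numerator tends to the Euler-Mascheroni constant while the denominator
    diverges.\<close>
  have "(\<lambda>n. (harm n - ln (real n)) / ln (real n) + 1) \<longlonglongrightarrow> 0 + (1::real)"
    by (intro tendsto_add tendsto_const tendsto_divide_0[OF euler_mascheroni_LIMSEQ]
          filterlim_at_top_imp_at_infinity ln)
  moreover have "\<forall>\<^sub>F n in sequentially. (harm n - ln (real n)) / ln (real n) + 1 = harm n / ln (real n)"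
    using eventually_gt_at_top[of 1]
  proof eventually_elim
    case (elim n)
    then have "ln (real n) \<noteq> 0" by simp
    then show ?case by (simp add: diff_divide_distrib)
  qed
  ultimately show ?thesis by (simp add: tendsto_cong)
qed

lemma inverse_sqrt_ln_tendsto: "(\<lambda>n. 1 / sqrt (ln (real n))) \<longlonglongrightarrow> 0"
  by (intro tendsto_divide_0[OF tendsto_const] filterlim_at_top_imp_at_infinity
        filterlim_compose[OF sqrt_at_top] filterlim_compose[OF ln_at_top] filterlim_real_sequentially)

text \<open>The cut-off 3 exceeds e; from there on 1 / sqrt (ln n) is an admissible \<theta> in
  [0, 1].\<close>

lemma ln_ge_one: "ln (real n) \<ge> 1" if "n \<ge> 3"
proof -
  have "exp 1 \<le> real n" using exp_le that by linarith
  then show ?thesis using that by (subst ln_ge_iff) auto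
qed

context critical_erw
begin

lemma E_char_tendsto:
  fixes g :: "real ^ 'd \<Rightarrow> real"
  assumes mean: "(\<Sum>v\<in>erw_dirs. g v) = 0"
    and var: "(\<Sum>v\<in>erw_dirs. (g v)\<^sup>2 - \<sigma>2) = 0"
    and B: "\<And>v. v \<in> erw_dirs \<Longrightarrow> \<bar>g v\<bar> \<le> B" and "\<sigma>2 \<ge> 0"
  shows "(\<lambda>n. E n (\<lambda>xs. cis (step_sum g xs / sqrt (real n * ln (real n))))) \<longlonglongrightarrow> complex_of_real (exp (- (\<sigma>2 / 2)))"
proof -
  obtain C where C: "\<And>n \<theta>. n > 0 \<Longrightarrow> 0 \<le> \<theta> \<Longrightarrow> \<theta> \<le> 1 \<Longrightarrow>
    norm (E n (\<lambda>xs. cis (\<theta> / sqrt (real n) * step_sum g xs)) - complex_of_real (exp (- (\<theta>\<^sup>2 * \<sigma>2 / 2 * harm n)))) \<le> \<theta> * C"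
    using E_char_bound[OF assms] by blast
  let ?u = "\<lambda>n. E n (\<lambda>xs. cis (step_sum g xs / sqrt (real n * ln (real n))))"
  let ?w = "\<lambda>n. complex_of_real (exp (- (\<sigma>2 / 2 * (harm n / ln (real n)))))"
  have "\<forall>\<^sub>F n in sequentially. norm (?u n - ?w n) \<le> 1 / sqrt (ln (real n)) * C"
    using eventually_ge_at_top[of 3]
  proof eventually_elim
    case (elim n)
    \<comment> \<open>This choice turns the scaling \<theta> / sqrt n into 1 / sqrt (n ln n) and the
      exponent \<theta>^2 H_n into H_n / ln n, which tends to 1.\<close>
    define \<theta> where "\<theta> = 1 / sqrt (ln (real n))"
    have ln: "ln (real n) \<ge> 1" using elim by (rule ln_ge_one)
    have \<theta>: "0 \<le> \<theta>" "\<theta> \<le> 1" using ln by (auto simp: \<theta>_def)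
    have \<theta>2: "\<theta>\<^sup>2 = 1 / ln (real n)" using ln by (simp add: \<theta>_def power_divide)
    have u: "?u n = E n (\<lambda>xs. cis (\<theta> / sqrt (real n) * step_sum g xs))"
      by (simp add: \<theta>_def real_sqrt_mult mult_ac)
    have w: "?w n = complex_of_real (exp (- (\<theta>\<^sup>2 * \<sigma>2 / 2 * harm n)))"
      by (simp add: \<theta>2)
    show ?case
      unfolding u w \<theta>_def[symmetric] using elim by (intro C \<theta>) simp
  qed
  moreover have "(\<lambda>n. 1 / sqrt (ln (real n)) * C) \<longlonglongrightarrow> 0"
    by (rule tendsto_mult_left_zero[OF inverse_sqrt_ln_tendsto])
  ultimately have "(\<lambda>n. ?u n - ?w n) \<longlonglongrightarrow> 0"
    by (rule Lim_null_comparison)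
  moreover have "?w \<longlonglongrightarrow> complex_of_real (exp (- (\<sigma>2 / 2 * 1)))"
    by (intro tendsto_intros harm_over_ln_tendsto)
  ultimately have "(\<lambda>n. ?u n - ?w n + ?w n) \<longlonglongrightarrow> 0 + complex_of_real (exp (- (\<sigma>2 / 2 * 1)))"
    by (rule tendsto_add)
  then show ?thesis by simp
qed

section \<open>Transfer from the position to the centre of mass\<close>

lemma abs_inner_erw_dirs: "\<bar>t \<bullet> v\<bar> \<le> norm t" if "v \<in> erw_dirs" for t v :: "real ^ 'd"
  using Cauchy_Schwarz_ineq2[of t v] norm_erw_dirs[OF that] by simp

lemma E_char_bary_tendsto:
  fixes t :: "real ^ 'd"
  shows "(\<lambda>n. E n (\<lambda>xs. cis (t \<bullet> ((1 / sqrt (real n * ln (real n))) *\<^sub>R erw_bary xs n))))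
    \<longlonglongrightarrow> complex_of_real (exp (- (4 / (9 * real CARD('d)) * (norm t)\<^sup>2 / 2)))"
proof -
  \<comment> \<open>The factor 2/3 is the asymptotic ratio of centre of mass to position; its square
    times the step variance |t|^2 / d gives \<sigma>2.\<close>
  define g where "g x = ((2 / 3) *\<^sub>R t) \<bullet> x" for x
  define B where "B = norm t"
  define \<sigma>2 where "\<sigma>2 = 4 / (9 * real CARD('d)) * (norm t)\<^sup>2"
  let ?G = "step_sum (\<lambda>x. t \<bullet> x)"
  have mean_t: "(\<Sum>v\<in>erw_dirs. t \<bullet> v) = 0" by (rule sum_erw_dirs_inner)
  have "(\<lambda>n. E n (\<lambda>xs. cis (step_sum g xs / sqrt (real n * ln (real n))))) \<longlonglongrightarrow> complex_of_real (exp (- (\<sigma>2 / 2)))"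
  proof (rule E_char_tendsto)
    show "(\<Sum>v\<in>erw_dirs. g v) = 0"
      unfolding g_def by (rule sum_erw_dirs_inner)
    show "(\<Sum>v\<in>erw_dirs. (g v)\<^sup>2 - \<sigma>2) = 0"
      unfolding g_def sum_subtractf sum_erw_dirs_inner_square
      by (simp add: card_erw_dirs \<sigma>2_def power_mult_distrib power2_eq_square)
    show "\<bar>g v\<bar> \<le> norm ((2 / 3) *\<^sub>R t)" if "v \<in> erw_dirs" for v
      unfolding g_def using that by (rule abs_inner_erw_dirs)
    show "\<sigma>2 \<ge> 0" by (simp add: \<sigma>2_def)
  qed
  moreover have "step_sum g xs = 2 / 3 * ?G xs" for xs
    by (induction xs) (simp_all add: g_def distrib_left)
  ultimately have lim: "(\<lambda>n. E n (\<lambda>xs. cis (2 / 3 * ?G xs / sqrt (real n * ln (real n))))) \<longlonglongrightarrow> complex_of_real (exp (- (\<sigma>2 / 2)))"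
    by simp
  let ?u = "\<lambda>n. E n (\<lambda>xs. cis (t \<bullet> ((1 / sqrt (real n * ln (real n))) *\<^sub>R erw_bary xs n)))"
  let ?w = "\<lambda>n. E n (\<lambda>xs. cis (2 / 3 * ?G xs / sqrt (real n * ln (real n))))"
  have "\<forall>\<^sub>F n in sequentially. norm (?u n - ?w n) \<le> 1 / sqrt (ln (real n)) * ((1 + B\<^sup>2) / 2 + B / 3)"
    using eventually_ge_at_top[of 3]
  proof eventually_elim
    case (elim n)
    define s where "s = sqrt (real n * ln (real n))"
    \<comment> \<open>The order of the standard deviation of the remainder, whose second moment is
      at most B^2 n^3.\<close>
    define c where "c = real n * sqrt (real n)"
    have n: "n > 0" and ln: "ln (real n) \<ge> 1" using elim ln_ge_one by auto
    have s: "s > 0" unfolding s_def real_sqrt_gt_0_iff using elim by (intro mult_pos_pos) auto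
    have c: "c > 0" using n by (simp add: c_def)
    let ?D = "\<lambda>xs. prefix_sums (\<lambda>x. t \<bullet> x) xs - (2 * real n + 1) / 3 * ?G xs"
    have "norm (?u n - ?w n) = norm (E n (\<lambda>xs. cis (t \<bullet> ((1 / s) *\<^sub>R erw_bary xs n)) - cis (2 / 3 * ?G xs / s)))"
      unfolding s_def by (simp add: integrable_erw_steps)
    also have "\<dots> \<le> E n (\<lambda>xs. norm (cis (t \<bullet> ((1 / s) *\<^sub>R erw_bary xs n)) - cis (2 / 3 * ?G xs / s)))"
      by (rule integral_norm_bound)
    also have "\<dots> \<le> E n (\<lambda>xs. (\<bar>?D xs\<bar> / real n + B / 3) / s)"
    proof (rule E_mono[OF n])
      fix xs assume h: "history n xs"
      then have xs: "length xs = n" "set xs \<subseteq> erw_dirs" by (auto simp: history_def)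
      have bary: "t \<bullet> erw_bary xs n = prefix_sums (\<lambda>x. t \<bullet> x) xs / real n"
        using inner_erw_bary[of t xs] xs by simp
      have G: "\<bar>?G xs\<bar> \<le> real n * B"
        using abs_step_sum_le[OF xs(2), of "\<lambda>x. t \<bullet> x" B] abs_inner_erw_dirs xs by (simp add: B_def)
      have "norm (cis (t \<bullet> ((1 / s) *\<^sub>R erw_bary xs n)) - cis (2 / 3 * ?G xs / s))
          \<le> \<bar>t \<bullet> ((1 / s) *\<^sub>R erw_bary xs n) - 2 / 3 * ?G xs / s\<bar>"
        by (rule norm_cis_diff)
      \<comment> \<open>The coefficient (2n + 1) / (3n) is 2/3 + 1/(3n), which leaves the small
        extra term in G.\<close>
      also have "t \<bullet> ((1 / s) *\<^sub>R erw_bary xs n) - 2 / 3 * ?G xs / s = (?D xs / real n + ?G xs / (3 * real n)) / s"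
        using n s by (simp add: bary field_simps)
      also have "\<bar>(?D xs / real n + ?G xs / (3 * real n)) / s\<bar> = \<bar>?D xs / real n + ?G xs / (3 * real n)\<bar> / s"
        using s by simp
      also have "\<dots> \<le> (\<bar>?D xs\<bar> / real n + B / 3) / s"
      proof (rule divide_right_mono)
        have "\<bar>?G xs / (3 * real n)\<bar> \<le> B / 3"
          using G n by (simp add: field_simps)
        moreover have "\<bar>?D xs / real n\<bar> = \<bar>?D xs\<bar> / real n" by simp
        ultimately show "\<bar>?D xs / real n + ?G xs / (3 * real n)\<bar> \<le> \<bar>?D xs\<bar> / real n + B / 3"
          using abs_triangle_ineq[of "?D xs / real n" "?G xs / (3 * real n)"] by linarith
      qed (use s in simp)
      finally show "norm (cis (t \<bullet> ((1 / s) *\<^sub>R erw_bary xs n)) - cis (2 / 3 * ?G xs / s)) \<le> (\<bar>?D xs\<bar> / real n + B / 3) / s" .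
    qed
    also have "\<dots> = (E n (\<lambda>xs. \<bar>?D xs\<bar>) / real n + B / 3) / s"
      by (simp add: integrable_erw_steps)
    also have "\<dots> \<le> ((1 + B\<^sup>2) / 2 * c / real n + B / 3) / s"
    proof -
      have "E n (\<lambda>xs. \<bar>?D xs\<bar>) \<le> E n (\<lambda>xs. (c + (?D xs)\<^sup>2 / c) / 2)"
        by (rule E_mono[OF n abs_le_half_add[OF c]])
      also have "\<dots> = (c + E n (\<lambda>xs. (?D xs)\<^sup>2) / c) / 2"
        by (simp add: integrable_erw_steps)
      also have "\<dots> \<le> (c + B\<^sup>2 * real n ^ 3 / c) / 2"
        using E_bary_remainder_square_le[OF mean_t _ n, of B] abs_inner_erw_dirs c
        by (intro divide_right_mono add_left_mono) (auto simp: B_def)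
      also have "real n ^ 3 = c * c"
        by (simp add: c_def power3_eq_cube)
      also have "(c + B\<^sup>2 * (c * c) / c) / 2 = (1 + B\<^sup>2) / 2 * c"
        using c by (simp add: field_simps)
      finally show ?thesis
        using n s by (intro divide_right_mono add_right_mono) auto
    qed
    also have "\<dots> = ((1 + B\<^sup>2) / 2 * sqrt (real n) + B / 3) / s"
      using n by (simp add: c_def)
    also have "\<dots> \<le> ((1 + B\<^sup>2) / 2 * sqrt (real n) + B / 3 * sqrt (real n)) / s"
      using n s by (intro divide_right_mono add_left_mono) (auto simp: B_def mult_le_cancel_left1)
    also have "\<dots> = 1 / sqrt (ln (real n)) * ((1 + B\<^sup>2) / 2 + B / 3)"
      unfolding distrib_right[symmetric] s_def real_sqrt_mult using n by simp
    finally show ?case .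
  qed
  moreover have "(\<lambda>n. 1 / sqrt (ln (real n)) * ((1 + B\<^sup>2) / 2 + B / 3)) \<longlonglongrightarrow> 0"
    by (rule tendsto_mult_left_zero[OF inverse_sqrt_ln_tendsto])
  ultimately have "(\<lambda>n. ?u n - ?w n) \<longlonglongrightarrow> 0"
    by (rule Lim_null_comparison)
  from tendsto_add[OF this lim] show ?thesis by (simp add: \<sigma>2_def)
qed

section \<open>Tightness of the rescaled centre of mass\<close>

lemma E_bary_square_le:
  fixes t :: "real ^ 'd"
  assumes "n > 0"
  shows "E n (\<lambda>xs. (t \<bullet> erw_bary xs n)\<^sup>2) \<le> 4 * (norm t)\<^sup>2 * real n * harm n"
proof -
  let ?G = "step_sum (\<lambda>x. t \<bullet> x)"
  let ?D = "\<lambda>xs. prefix_sums (\<lambda>x. t \<bullet> x) xs - (2 * real n + 1) / 3 * ?G xs"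
  have mean: "(\<Sum>v\<in>erw_dirs. t \<bullet> v) = 0" by (rule sum_erw_dirs_inner)
  have "E n (\<lambda>xs. (t \<bullet> erw_bary xs n)\<^sup>2) \<le> E n (\<lambda>xs. 2 / (real n)\<^sup>2 * (?D xs)\<^sup>2 + 2 * (?G xs)\<^sup>2)"
  proof (rule E_mono[OF assms])
    fix xs assume h: "history n xs"
    then have xs: "length xs = n" by (simp add: history_def)
    \<comment> \<open>Martingale remainder and multiple of the position; the coefficient (2n + 1) /
      (3n) of the latter is at most 1.\<close>
    define a b where "a = ?D xs / real n" and "b = (2 * real n + 1) / (3 * real n) * ?G xs"
    have ab: "t \<bullet> erw_bary xs n = a + b"
      using inner_erw_bary[of t xs] xs assms by (simp add: a_def b_def field_simps)
    have "(a + b)\<^sup>2 \<le> 2 * a\<^sup>2 + 2 * b\<^sup>2"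
      using sum_squares_bound[of a b] by (simp add: power2_sum)
    moreover have "b\<^sup>2 \<le> (?G xs)\<^sup>2"
    proof -
      have "((2 * real n + 1) / (3 * real n))\<^sup>2 \<le> 1\<^sup>2"
        using assms by (intro power_mono) (auto simp: field_simps)
      then show ?thesis
        unfolding b_def power_mult_distrib by (intro mult_left_le_one_le) auto
    qed
    moreover have "2 * a\<^sup>2 = 2 / (real n)\<^sup>2 * (?D xs)\<^sup>2"
      by (simp add: a_def power_divide)
    ultimately have "(a + b)\<^sup>2 \<le> 2 / (real n)\<^sup>2 * (?D xs)\<^sup>2 + 2 * (?G xs)\<^sup>2"
      by linarith
    then show "(t \<bullet> erw_bary xs n)\<^sup>2 \<le> 2 / (real n)\<^sup>2 * (?D xs)\<^sup>2 + 2 * (?G xs)\<^sup>2"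
      by (simp only: ab)
  qed
  also have "\<dots> = 2 / (real n)\<^sup>2 * E n (\<lambda>xs. (?D xs)\<^sup>2) + 2 * E n (\<lambda>xs. (?G xs)\<^sup>2)"
    by (simp add: integrable_erw_steps)
  also have "\<dots> \<le> 2 / (real n)\<^sup>2 * ((norm t)\<^sup>2 * real n ^ 3) + 2 * ((norm t)\<^sup>2 * real n * harm n)"
    using assms abs_inner_erw_dirs
    by (intro add_mono mult_left_mono E_bary_remainder_square_le[OF mean] E_step_sum_square_le[OF mean]) auto
  also have "2 / (real n)\<^sup>2 * ((norm t)\<^sup>2 * real n ^ 3) = 2 * ((norm t)\<^sup>2 * real n * 1)"
    using assms by (simp add: power2_eq_square power3_eq_cube)
  \<comment> \<open>The remainder is only of order n; H_n >= 1 absorbs it into the bound for the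
    position.\<close>
  also have "2 * ((norm t)\<^sup>2 * real n * 1) \<le> 2 * ((norm t)\<^sup>2 * real n * harm n)"
    using harm_mono[of 1 n, where 'a = real] assms
    by (intro mult_left_mono) (auto simp: harm_def)
  finally show ?thesis by (simp add: mult_ac)
qed

text \<open>Chebyshev's inequality in each coordinate, summed over the coordinates.\<close>

lemma bary_tight:
  assumes "e > 0"
  shows "\<exists>R>0. \<forall>\<^sub>F n in sequentially.
    measure (measure_pmf (map_pmf (\<lambda>xs. (1 / sqrt (real n * ln (real n))) *\<^sub>R erw_bary xs n) (walk n)))
      {x. \<exists>i. R < \<bar>x $ i\<bar>} < e"
proof -
  \<comment> \<open>Eventually H_n / ln n < 2, so the Chebyshev bound is below 8d / R^2, hence below
    9d / R^2 = e.\<close>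
  define R where "R = sqrt (9 * real CARD('d) / e)"
  have R: "R > 0" and R2: "R\<^sup>2 = 9 * real CARD('d) / e"
    using assms by (auto simp: R_def)
  have "\<forall>\<^sub>F n in sequentially. harm n / ln (real n) < 2"
    by (rule order_tendstoD(2)[OF harm_over_ln_tendsto]) simp
  then have "\<forall>\<^sub>F n in sequentially.
    measure (measure_pmf (map_pmf (\<lambda>xs. (1 / sqrt (real n * ln (real n))) *\<^sub>R erw_bary xs n) (walk n)))
      {x. \<exists>i. R < \<bar>x $ i\<bar>} < e"
    using eventually_ge_at_top[of 3]
  proof eventually_elim
    case (elim n)
    define s where "s = real n * ln (real n)"
    have n: "n > 0" and ln: "ln (real n) \<ge> 1" using elim ln_ge_one by auto
    have s: "s > 0" unfolding s_def using elim by (intro mult_pos_pos) auto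
    let ?X = "\<lambda>xs :: (real ^ 'd) list. (1 / sqrt s) *\<^sub>R erw_bary xs n"
    let ?A = "{x :: real ^ 'd. \<exists>i. R < \<bar>x $ i\<bar>}"
    have "measure (measure_pmf (map_pmf ?X (walk n))) ?A = E n (\<lambda>xs. indicator ?A (?X xs))"
      using integral_map_pmf[of ?X "walk n" "indicator ?A :: _ \<Rightarrow> real"] by simp
    also have "\<dots> \<le> E n (\<lambda>xs. \<Sum>i\<in>UNIV. (axis i 1 \<bullet> erw_bary xs n)\<^sup>2 / (s * R\<^sup>2))"
    proof (rule E_mono[OF n])
      fix xs :: "(real ^ 'd) list"
      have sq: "(?X xs $ i)\<^sup>2 / R\<^sup>2 = (axis i 1 \<bullet> erw_bary xs n)\<^sup>2 / (s * R\<^sup>2)" for i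
        using s by (simp add: inner_axis' power_divide)
      show "indicator ?A (?X xs) \<le> (\<Sum>i\<in>UNIV. (axis i 1 \<bullet> erw_bary xs n)\<^sup>2 / (s * R\<^sup>2))"
      proof (cases "?X xs \<in> ?A")
        case True
        then obtain i where i: "R < \<bar>?X xs $ i\<bar>" by blast
        have "R\<^sup>2 \<le> (?X xs $ i)\<^sup>2"
          using i R by (simp only: abs_le_square_iff[symmetric])
        then have "1 \<le> (?X xs $ i)\<^sup>2 / R\<^sup>2" using R by simp
        also have "\<dots> = (axis i 1 \<bullet> erw_bary xs n)\<^sup>2 / (s * R\<^sup>2)" by (rule sq)
        also have "\<dots> \<le> (\<Sum>i\<in>UNIV. (axis i 1 \<bullet> erw_bary xs n)\<^sup>2 / (s * R\<^sup>2))"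
          using s by (intro member_le_sum) auto
        finally show ?thesis using True by (simp only: indicator_simps)
      next
        case False
        then have "indicator ?A (?X xs) = (0 :: real)" by (rule indicator_simps(2))
        also have "\<dots> \<le> (\<Sum>i\<in>UNIV. (axis i 1 \<bullet> erw_bary xs n)\<^sup>2 / (s * R\<^sup>2))"
          using s by (intro sum_nonneg) auto
        finally show ?thesis .
      qed
    qed
    also have "\<dots> = (\<Sum>i\<in>UNIV. E n (\<lambda>xs. (axis i 1 \<bullet> erw_bary xs n)\<^sup>2) / (s * R\<^sup>2))"
      by (simp add: integrable_erw_steps)
    also have "\<dots> \<le> (\<Sum>i\<in>(UNIV :: 'd set). 4 * real n * harm n / (s * R\<^sup>2))"
    proof (intro sum_mono divide_right_mono)
      fix i :: 'd
      show "E n (\<lambda>xs. (axis i 1 \<bullet> erw_bary xs n)\<^sup>2) \<le> 4 * real n * harm n"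
        using E_bary_square_le[OF n, of "axis i 1"] by simp
    qed (use s in simp)
    also have "\<dots> = real CARD('d) * (4 * (harm n / ln (real n)) / R\<^sup>2)"
      using n ln by (simp add: s_def)
    also have "\<dots> < real CARD('d) * (9 / R\<^sup>2)"
      using elim(1) R by (intro mult_strict_left_mono divide_strict_right_mono) auto
    also have "\<dots> = e"
      using assms by (simp add: R2)
    finally show ?case unfolding s_def .
  qed
  with R show ?thesis by blast
qed

end

section \<open>The limit law of the centre of mass\<close>

theorem theorem2p6:
  fixes p :: real
  assumes "p = (2 * real CARD('d::finite) + 1) / (4 * real CARD('d))"
  shows "conv_in_law
           (\<lambda>n. measure_pmf (map_pmf
                   (\<lambda>xs. (1 / sqrt (real n * ln (real n))) *\<^sub>R erw_bary xs n)
                   (erw_steps p n :: (real ^ 'd) list pmf)))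
           (gauss_iso (4 / (9 * real CARD('d))) :: (real ^ 'd) measure)"
proof -
  interpret critical_erw p "TYPE('d)"
    by unfold_locales (rule assms)
  have s: "4 / (9 * real CARD('d)) > 0" by simp
  show ?thesis
  \<comment> \<open>For n = 0 and n = 1 the scaling is 1 / 0 = 0: still a probability law, and
    irrelevant in the limit.\<close>
  proof (rule conv_in_law_if_char_tendsto)
    show "(\<lambda>n. \<integral>x. cis (t \<bullet> x) \<partial>measure_pmf (map_pmf (\<lambda>xs. (1 / sqrt (real n * ln (real n))) *\<^sub>R erw_bary xs n) (walk n)))
        \<longlonglongrightarrow> (\<integral>x. cis (t \<bullet> x) \<partial>gauss_iso (4 / (9 * real CARD('d))))" for t :: "real ^ 'd"
      using E_char_bary_tendsto[of t] unfolding char_gauss_iso[OF s] integral_map_pmf .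
    show "\<exists>R>0. \<forall>\<^sub>F n in sequentially.
        measure (measure_pmf (map_pmf (\<lambda>xs. (1 / sqrt (real n * ln (real n))) *\<^sub>R erw_bary xs n) (walk n)))
          {x. \<exists>i. R < \<bar>x $ i\<bar>} < e" if "e > 0" for e
      using that by (rule bary_tight)
  qed (auto intro!: prob_space_gauss_iso s prob_space_measure_pmf simp: sets_gauss_iso)
qed

end
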